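(* Let $(A_1,\ldots,A_d)$ be a $d$-tuple of commuting dissipative operators on a separable Hilbert space $\mathcal{H}$ having the dissipative embedding property, embedded in a vessel $\mathfrak{V}$ realizing this property, and let $\mathcal{W}=\bigcap_{j=1}^d\ker\Phi^*\sigma_j$. If there exists a closed subspace $0\ne\mathcal{M}\subset\mathcal{W}$ invariant under $\alpha_j$ and $\beta_j$ for every $j=1,\ldots,d$, then the dilation $\rho$ constructed from $\mathfrak{V}$ on $\mathcal{K}=L^2(\mathbb{R}_{<0},\mathcal{E})\oplus\mathcal{H}\oplus L^2(\mathbb{R}_{>0},\mathcal{E})$ (as described in the context) is not minimal. In other words, if this dilation is minimal then there is no such subspace of $\mathcal{W}$.
   Context: Vessel. A collection $\mathfrak{V}=(\mathcal{H},\mathcal{E},\Phi,\{A_j\},\{\sigma_j\},\{\gamma_{jk}\},\{\gamma_{*jk}\})$, where $\mathcal{H},\mathcal{E}$ are separable Hilbert spaces, $A_1,\ldots,A_d$ are commuting bounded operators on $\mathcal{H}$, $\Phi:\mathcal{H}\to\mathcal{E}$ is bounded, and $\sigma_j,\gamma_{jk},\gamma_{*jk}$ are bounded selfadjoint operators on $\mathcal{E}$ such that for all $j,k=1,\ldots,d$: $A_k-A_k^*=i\Phi^*\sigma_k\Phi$; $\gamma_{jk}=-\gamma_{kj}$, $\gamma_{*jk}=-\gamma_{*kj}$; $\sigma_j\Phi A_k^*-\sigma_k\Phi A_j^*=\gamma_{jk}\Phi$; $\sigma_j\Phi A_k-\sigma_k\Phi A_j=\gamma_{*jk}\Phi$;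 $\gamma_{*jk}-\gamma_{jk}=i(\sigma_j\Phi\Phi^*\sigma_k-\sigma_k\Phi\Phi^*\sigma_j)$. $\mathrm{Pos}(\mathfrak{V})=\{\xi\in\mathbb{R}^d:\exists\,\epsilon>0,\ \sum_j\xi_j\sigma_j>\epsilon I_{\mathcal{E}}\}$. Dissipative embedding property, realized by $\mathfrak{V}$: $\mathfrak{V}$ satisfies the VR conditions below, $\mathrm{Pos}(\mathfrak{V})\ne\emptyset$, and every standard basis vector $e_j\in\overline{\mathrm{Pos}(\mathfrak{V})}$. As in the paper's construction, linear coordinates on $\mathbb{R}^d$ are chosen so that $e_1\in\mathrm{Pos}(\mathfrak{V})$, and the inner product of $\mathcal{E}$ is normalized (replaced by $\langle\sigma_1\cdot,\cdot\rangle$) so that $\sigma_1=I_{\mathcal{E}}$; the VR conditions then read, for $j,k\ge2$, with $\alpha_j=\sigma_j$, $\beta_j=\gamma_{1j}$: $[\alpha_j,\alpha_k]=0$, $[\beta_j,\beta_k]=0$, $[\alpha_k,\beta_j]=[\alpha_j,\beta_k]$, $\gamma_{jk}=\sigma_j\gamma_{1k}-\sigma_k\gamma_{1j}$. Put $\alpha_1=I$, $\beta_1=0$ and $\beta_{*j}=\gamma_{*1j}$ ($\beta_{*1}=0$). Construction of $\rho$. For $(y,h,u)\in\mathcal{K}$ set $x(t)=e^{itA_1}(h-i\int_0^te^{-isA_1}\Phi^*u(s)ds)$ for $t>0$ and $x(t)=e^{itA_1^*}(h+i\int_t^0e^{-isA_1^*}\Phi^*y(s)ds)$ for $t<0$;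 let $\tilde y=y$ on $\mathbb{R}_{<0}$, $\tilde y=u-i\Phi x$ on $\mathbb{R}_{>0}$, and $\tilde u=u$ on $\mathbb{R}_{>0}$, $\tilde u=y+i\Phi x$ on $\mathbb{R}_{<0}$. Then $\tilde u,\tilde y\in L^2(\mathbb{R},\mathcal{E})$. Let $\mathcal{K}_0$ be the (dense) subspace of triples for which $\tilde u,\tilde y$ are twice continuously differentiable on $\mathbb{R}$ with square-integrable first and second derivatives. For $(y,h,u)\in\mathcal{K}_0$ and $t\in\mathbb{R}^d$ put $$u^\dagger(t)=\frac1{\sqrt{2\pi}}\int_{\mathbb{R}}e^{i\sum_jt_j(s\alpha_j+\beta_j)}\mathcal{F}(\tilde u)(s)ds,\quad y^\dagger(t)=\frac1{\sqrt{2\pi}}\int_{\mathbb{R}}e^{i\sum_jt_j(s\alpha_j+\beta_{*j})}\mathcal{F}(\tilde y)(s)ds,$$ where $\mathcal{F}(f)(s)=\frac1{\sqrt{2\pi}}\int e^{-ist}f(t)dt$; these solve $\sigma_k\partial_ju-\sigma_j\partial_ku+i\gamma_{jk}u=0$, respectively the same system with $\gamma_{*jk}$. Let $x:\mathbb{R}^d\to\mathcal{H}$ be $$x(t)=e^{i\sum_jt_jA_j}\Big(h-i\int_0^{t}e^{-i\sum_js_jA_j}\Phi^*\sum_j\sigma_ju^\dagger(s)ds_j\Big)$$ (a path-independent line integral from $0$ to $t$). Define $\rho(t)(y,h,u)=(y_t,x(t),u_t)$ with $y_t(s)=y^\dagger(t_1+s,t_2,\ldots,t_d)$ for $s<0$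 and $u_t(s)=u^\dagger(t_1+s,t_2,\ldots,t_d)$ for $s>0$. For $t\in\mathrm{Pos}(\mathfrak{V})\cup-\mathrm{Pos}(\mathfrak{V})$, $\rho(t)$ extends to a unitary on $\mathcal{K}$, and these extend to a unitary representation $\rho$ of $\mathbb{R}^d$ on $\mathcal{K}$ dilating the semigroup $e^{i\sum t_jA_j}$, with $\mathcal{H}\subset\mathcal{K}$ via $h\mapsto(0,h,0)$. Minimality: $\rho$ is minimal if $\overline{\mathrm{Span}\{\rho(t)\mathcal{H}:t\in\mathbb{R}^d\}}=\mathcal{K}$. *)

theory Defs
  imports "HOL-Analysis.Analysis" "HOL-Library.Function_Algebras"
begin

section \<open>Complex Hilbert spaces and their operators\<close>

text \<open>
  A complex Hilbert space is a real one (which supplies the norm, the topology and Bochner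
  integration) together with a complex scalar multiplication extending the real one and a
  sesquilinear form, linear in the first argument, whose real part is the real inner product.
  Separability is the additional class constraint \<open>second_countable_topology\<close>.
\<close>

class chilbert_space = real_inner + banach +
  fixes scaleC :: "complex \<Rightarrow> 'a \<Rightarrow> 'a"  (infixr \<open>*\<^sub>C\<close> 75)
    and cinner :: "'a \<Rightarrow> 'a \<Rightarrow> complex"
  assumes scaleC_add_right: "c *\<^sub>C (x + y) = c *\<^sub>C x + c *\<^sub>C y"
    and scaleC_add_left: "(b + c) *\<^sub>C x = b *\<^sub>C x + c *\<^sub>C x"
    and scaleC_scaleC: "b *\<^sub>C (c *\<^sub>C x) = (b * c) *\<^sub>C x"
    and scaleC_of_real: "complex_of_real r *\<^sub>C x = r *\<^sub>R x"
    and cinner_commute: "cinner x y = cnj (cinner y x)"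
    and cinner_add_left: "cinner (x + y) z = cinner x z + cinner y z"
    and cinner_scaleC_left: "cinner (c *\<^sub>C x) y = c * cinner x y"
    and inner_eq_Re_cinner: "inner x y = Re (cinner x y)"

instantiation complex :: chilbert_space
begin

definition scaleC_complex :: "complex \<Rightarrow> complex \<Rightarrow> complex"
  where "scaleC_complex c x = c * x"

definition cinner_complex :: "complex \<Rightarrow> complex \<Rightarrow> complex"
  where "cinner_complex x y = x * cnj y"

instance
  by standard
    (simp_all add: scaleC_complex_def cinner_complex_def algebra_simps inner_complex_def
      scaleR_conv_of_real)

end

definition bounded_clinear :: "('a::chilbert_space \<Rightarrow> 'b::chilbert_space) \<Rightarrow> bool"
  where "bounded_clinear T \<longleftrightarrow> bounded_linear T \<and> (\<forall>c x. T (c *\<^sub>C x) = c *\<^sub>C T x)"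

definition cadjoint :: "('a::chilbert_space \<Rightarrow> 'b::chilbert_space) \<Rightarrow> 'b \<Rightarrow> 'a"
  where "cadjoint T = (SOME S. \<forall>x y. cinner (T x) y = cinner x (S y))"

definition bounded_selfadjoint :: "('a::chilbert_space \<Rightarrow> 'a) \<Rightarrow> bool"
  where "bounded_selfadjoint T \<longleftrightarrow>
    bounded_clinear T \<and> (\<forall>x y. cinner (T x) y = cinner x (T y))"

definition dissipative :: "('a::chilbert_space \<Rightarrow> 'a) \<Rightarrow> bool"
  where "dissipative T \<longleftrightarrow> (\<forall>x. 0 \<le> Im (cinner (T x) x))"

definition commutator :: "('a::chilbert_space \<Rightarrow> 'a) \<Rightarrow> ('a \<Rightarrow> 'a) \<Rightarrow> 'a \<Rightarrow> 'a"
  where "commutator S T = (\<lambda>v. S (T v) - T (S v))"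

text \<open>\<open>expi T\<close> is the operator exponential of \<open>\<i> T\<close>.\<close>

definition expi :: "('a::chilbert_space \<Rightarrow> 'a) \<Rightarrow> 'a \<Rightarrow> 'a"
  where "expi T v = (\<Sum>n. (\<i> ^ n / fact n) *\<^sub>C (T ^^ n) v)"

definition closed_csubspace :: "'a::chilbert_space set \<Rightarrow> bool"
  where "closed_csubspace M \<longleftrightarrow>
    closed M \<and> 0 \<in> M \<and> (\<forall>x\<in>M. \<forall>y\<in>M. x + y \<in> M) \<and> (\<forall>c. \<forall>x\<in>M. c *\<^sub>C x \<in> M)"


section \<open>Vessels\<close>

text \<open>
  The indices \<open>1, \<dots>, d\<close> are the elements of a finite type \<open>'n\<close>. The class \<open>one\<close> (which has no
  axioms) singles out the first index, and \<open>real ^ 'n\<close> plays the role of \<open>\<real>\<^sup>d\<close>.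
\<close>

record ('h, 'e, 'n) vessel =
  opA :: "'n \<Rightarrow> 'h \<Rightarrow> 'h"
  Phi :: "'h \<Rightarrow> 'e"
  sigma :: "'n \<Rightarrow> 'e \<Rightarrow> 'e"
  gam :: "'n \<Rightarrow> 'n \<Rightarrow> 'e \<Rightarrow> 'e"
  gams :: "'n \<Rightarrow> 'n \<Rightarrow> 'e \<Rightarrow> 'e"

definition is_vessel :: "('h::chilbert_space, 'e::chilbert_space, 'n::finite) vessel \<Rightarrow> bool"
  where "is_vessel V \<longleftrightarrow>
    (\<forall>j. bounded_clinear (opA V j)) \<and>
    (\<forall>j k x. opA V j (opA V k x) = opA V k (opA V j x)) \<and>
    bounded_clinear (Phi V) \<and>
    (\<forall>j. bounded_selfadjoint (sigma V j)) \<and>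
    (\<forall>j k. bounded_selfadjoint (gam V j k)) \<and>
    (\<forall>j k. bounded_selfadjoint (gams V j k)) \<and>
    (\<forall>k x. opA V k x - cadjoint (opA V k) x
            = \<i> *\<^sub>C cadjoint (Phi V) (sigma V k (Phi V x))) \<and>
    (\<forall>j k v. gam V j k v = - gam V k j v) \<and>
    (\<forall>j k v. gams V j k v = - gams V k j v) \<and>
    (\<forall>j k x. sigma V j (Phi V (cadjoint (opA V k) x)) - sigma V k (Phi V (cadjoint (opA V j) x))
            = gam V j k (Phi V x)) \<and>
    (\<forall>j k x. sigma V j (Phi V (opA V k x)) - sigma V k (Phi V (opA V j x))
            = gams V j k (Phi V x)) \<and>
    (\<forall>j k v. gams V j k v - gam V j k v
            = \<i> *\<^sub>C (sigma V j (Phi V (cadjoint (Phi V) (sigma V k v)))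
                  - sigma V k (Phi V (cadjoint (Phi V) (sigma V j v)))))"

definition Pos :: "('h::chilbert_space, 'e::chilbert_space, 'n::finite) vessel \<Rightarrow> (real ^ 'n) set"
  where "Pos V = {\<xi>. \<exists>\<epsilon>>0. \<forall>v. v \<noteq> 0 \<longrightarrow>
    \<epsilon> * (norm v)\<^sup>2 < Re (cinner (\<Sum>j\<in>UNIV. (\<xi> $ j) *\<^sub>R sigma V j v) v)}"

text \<open>
  With the normalization \<open>\<sigma>\<^sub>1 = I\<close> one has \<open>\<alpha>\<^sub>1 = I\<close>, and antisymmetry of \<open>\<gamma>\<close> and \<open>\<gamma>\<^sub>*\<close> gives
  \<open>\<beta>\<^sub>1 = \<beta>\<^bsub>*1\<^esub> = 0\<close>.
\<close>

abbreviation alpha :: "('h, 'e, 'n) vessel \<Rightarrow> 'n \<Rightarrow> 'e \<Rightarrow> 'e"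
  where "alpha V j \<equiv> sigma V j"

abbreviation beta :: "('h, 'e, 'n::one) vessel \<Rightarrow> 'n \<Rightarrow> 'e \<Rightarrow> 'e"
  where "beta V j \<equiv> gam V 1 j"

abbreviation betas :: "('h, 'e, 'n::one) vessel \<Rightarrow> 'n \<Rightarrow> 'e \<Rightarrow> 'e"
  where "betas V j \<equiv> gams V 1 j"

definition VR_conditions ::
    "('h::chilbert_space, 'e::chilbert_space, 'n::{finite,one}) vessel \<Rightarrow> bool"
  where "VR_conditions V \<longleftrightarrow> (\<forall>j k. j \<noteq> 1 \<longrightarrow> k \<noteq> 1 \<longrightarrow>
    commutator (alpha V j) (alpha V k) = (\<lambda>v. 0) \<and>
    commutator (beta V j) (beta V k) = (\<lambda>v. 0) \<and>
    commutator (alpha V k) (beta V j) = commutator (alpha V j) (beta V k) \<and>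
    (\<forall>v. gam V j k v = sigma V j (gam V 1 k v) - sigma V k (gam V 1 j v)))"

text \<open>
  The conditions under which a vessel realizes the dissipative embedding property, in
  coordinates on \<open>\<real>\<^sup>d\<close> with \<open>e\<^sub>1 \<in> Pos V\<close> and with the inner product of \<open>\<E>\<close> normalized so
  that \<open>\<sigma>\<^sub>1 = I\<close>.
\<close>

definition realizes_dissipative_embedding ::
    "('h::chilbert_space, 'e::chilbert_space, 'n::{finite,one}) vessel \<Rightarrow> bool"
  where "realizes_dissipative_embedding V \<longleftrightarrow>
    is_vessel V \<and>
    (\<forall>v. sigma V 1 v = v) \<and>
    VR_conditions V \<and>
    axis 1 1 \<in> Pos V \<and>
    (\<forall>j. axis j 1 \<in> closure (Pos V))"

definition kernel_W :: "('h::chilbert_space, 'e::chilbert_space, 'n::finite) vessel \<Rightarrow> 'e set"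
  where "kernel_W V = (\<Inter>j. {v. cadjoint (Phi V) (sigma V j v) = 0})"


section \<open>The space \<open>\<K> = L\<^sup>2(\<real>\<^sub><\<^sub>0, \<E>) \<oplus> \<H> \<oplus> L\<^sup>2(\<real>\<^sub>>\<^sub>0, \<E>)\<close>\<close>

text \<open>
  Elements of \<open>\<K>\<close> are represented by triples \<open>(y, h, u)\<close> of which only \<open>y\<close> on the negative and
  \<open>u\<close> on the positive half line matter; equality in \<open>\<K>\<close> is the relation \<open>K_eq\<close>.
\<close>

type_synonym ('h, 'e) kvec = "(real \<Rightarrow> 'e) \<times> 'h \<times> (real \<Rightarrow> 'e)"

definition square_integrable ::
    "real set \<Rightarrow> (real \<Rightarrow> 'e::{chilbert_space,second_countable_topology}) \<Rightarrow> bool"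
  where "square_integrable S f \<longleftrightarrow>
    set_borel_measurable borel S f \<and> set_integrable lborel S (\<lambda>s. (norm (f s))\<^sup>2)"

definition K_space ::
    "('h::chilbert_space, 'e::{chilbert_space,second_countable_topology}) kvec set"
  where "K_space = {(y, h, u). square_integrable {..<0} y \<and> square_integrable {0<..} u}"

fun K_eq :: "('h, 'e) kvec \<Rightarrow> ('h, 'e) kvec \<Rightarrow> bool"
  where "K_eq (y, h, u) (y', h', u') \<longleftrightarrow>
    (AE s in lborel. s < 0 \<longrightarrow> y s = y' s) \<and> h = h' \<and> (AE s in lborel. 0 < s \<longrightarrow> u s = u' s)"

fun K_norm :: "('h::chilbert_space, 'e::chilbert_space) kvec \<Rightarrow> real"
  where "K_norm (y, h, u) = sqrt
    ((LINT s:{..<0}|lborel. (norm (y s))\<^sup>2) + (norm h)\<^sup>2 + (LINT s:{0<..}|lborel. (norm (u s))\<^sup>2))"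

fun K_scale :: "complex \<Rightarrow> ('h::chilbert_space, 'e::chilbert_space) kvec \<Rightarrow> ('h, 'e) kvec"
  where "K_scale c (y, h, u) = ((\<lambda>s. c *\<^sub>C y s), c *\<^sub>C h, (\<lambda>s. c *\<^sub>C u s))"

definition K_embed :: "'h::chilbert_space \<Rightarrow> ('h, 'e::chilbert_space) kvec"
  where "K_embed h = ((\<lambda>s. 0), h, (\<lambda>s. 0))"

definition K_unitary ::
    "(('h::chilbert_space, 'e::{chilbert_space,second_countable_topology}) kvec \<Rightarrow> ('h, 'e) kvec)
      \<Rightarrow> bool"
  where "K_unitary U \<longleftrightarrow>
    (\<forall>k\<in>K_space. U k \<in> K_space \<and> K_norm (U k) = K_norm k) \<and>
    (\<forall>a b. \<forall>k\<in>K_space. \<forall>k'\<in>K_space.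
       K_eq (U (K_scale a k + K_scale b k')) (K_scale a (U k) + K_scale b (U k'))) \<and>
    (\<forall>k'\<in>K_space. \<exists>k\<in>K_space. K_eq (U k) k')"

definition K_unitary_representation ::
    "(real ^ 'n::finite \<Rightarrow> ('h::chilbert_space, 'e::{chilbert_space,second_countable_topology}) kvec
      \<Rightarrow> ('h, 'e) kvec) \<Rightarrow> bool"
  where "K_unitary_representation \<rho> \<longleftrightarrow>
    (\<forall>t. K_unitary (\<rho> t)) \<and>
    (\<forall>k\<in>K_space. K_eq (\<rho> 0 k) k) \<and>
    (\<forall>s t. \<forall>k\<in>K_space. K_eq (\<rho> (s + t) k) (\<rho> s (\<rho> t k))) \<and>
    (\<forall>k\<in>K_space. \<forall>t. ((\<lambda>s. K_norm (\<rho> s k - \<rho> t k)) \<longlongrightarrow> 0) (at t))"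

text \<open>The closed linear span of all \<open>\<rho>(t)\<H>\<close> is \<open>\<K>\<close>.\<close>

definition minimal_dilation ::
    "(real ^ 'n::finite \<Rightarrow> ('h::chilbert_space, 'e::{chilbert_space,second_countable_topology}) kvec
      \<Rightarrow> ('h, 'e) kvec) \<Rightarrow> bool"
  where "minimal_dilation \<rho> \<longleftrightarrow>
    (\<forall>k\<in>K_space. \<forall>\<epsilon>>0. \<exists>(N::nat) c t h.
       K_norm (k - (\<Sum>i<N. K_scale (c i) (\<rho> (t i) (K_embed (h i))))) < \<epsilon>)"


section \<open>Construction of the dilation\<close>

fun x_line ::
    "('h::{chilbert_space,second_countable_topology},
      'e::{chilbert_space,second_countable_topology}, 'n::{finite,one}) vessel
      \<Rightarrow> ('h, 'e) kvec \<Rightarrow> real \<Rightarrow> 'h"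
  where "x_line V (y, h, u) t =
    (if 0 \<le> t then
       expi (\<lambda>v. t *\<^sub>R opA V 1 v)
         (h - \<i> *\<^sub>C (LINT s:{0..t}|lborel.
            expi (\<lambda>v. (- s) *\<^sub>R opA V 1 v) (cadjoint (Phi V) (u s))))
     else
       expi (\<lambda>v. t *\<^sub>R cadjoint (opA V 1) v)
         (h + \<i> *\<^sub>C (LINT s:{t..0}|lborel.
            expi (\<lambda>v. (- s) *\<^sub>R cadjoint (opA V 1) v) (cadjoint (Phi V) (y s)))))"

text \<open>The values of \<open>y_tilde\<close> and \<open>u_tilde\<close> at \<open>0\<close> are immaterial.\<close>

fun y_tilde ::
    "('h::{chilbert_space,second_countable_topology},
      'e::{chilbert_space,second_countable_topology}, 'n::{finite,one}) vessel
      \<Rightarrow> ('h, 'e) kvec \<Rightarrow> real \<Rightarrow> 'e"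
  where "y_tilde V (y, h, u) t =
    (if t < 0 then y t else u t - \<i> *\<^sub>C Phi V (x_line V (y, h, u) t))"

fun u_tilde ::
    "('h::{chilbert_space,second_countable_topology},
      'e::{chilbert_space,second_countable_topology}, 'n::{finite,one}) vessel
      \<Rightarrow> ('h, 'e) kvec \<Rightarrow> real \<Rightarrow> 'e"
  where "u_tilde V (y, h, u) t =
    (if 0 < t then u t else y t + \<i> *\<^sub>C Phi V (x_line V (y, h, u) t))"

text \<open>
  As elements of \<open>L\<^sup>2(\<real>, \<E>)\<close> are only determined almost everywhere, smoothness is required of
  some representative.
\<close>

definition twice_C_L2 ::
    "(real \<Rightarrow> 'e::{chilbert_space,second_countable_topology}) \<Rightarrow> bool"
  where "twice_C_L2 f \<longleftrightarrow> (\<exists>g g' g''.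
    (AE t in lborel. f t = g t) \<and>
    (\<forall>t. (g has_vector_derivative g' t) (at t)) \<and>
    (\<forall>t. (g' has_vector_derivative g'' t) (at t)) \<and>
    continuous_on UNIV g'' \<and>
    square_integrable UNIV g' \<and> square_integrable UNIV g'')"

definition K_smooth ::
    "('h::{chilbert_space,second_countable_topology},
      'e::{chilbert_space,second_countable_topology}, 'n::{finite,one}) vessel
      \<Rightarrow> ('h, 'e) kvec set"
  where "K_smooth V = {k \<in> K_space. twice_C_L2 (u_tilde V k) \<and> twice_C_L2 (y_tilde V k)}"

text \<open>
  The Fourier transform on \<open>L\<^sup>2(\<real>, \<E>)\<close>: the integral over \<open>\<real>\<close> is the limit in \<open>L\<^sup>2\<close> of the
  integrals over \<open>[-n, n]\<close>. This determines the transform almost everywhere.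
\<close>

definition is_fourier ::
    "(real \<Rightarrow> 'e::{chilbert_space,second_countable_topology}) \<Rightarrow> (real \<Rightarrow> 'e) \<Rightarrow> bool"
  where "is_fourier f g \<longleftrightarrow>
    square_integrable UNIV g \<and>
    (\<lambda>n::nat. \<integral>\<^sup>+ s. ennreal ((norm (g s - (1 / sqrt (2 * pi)) *\<^sub>R
        (LINT t:{- real n..real n}|lborel. cis (- (s * t)) *\<^sub>C f t)))\<^sup>2) \<partial>lborel)
      \<longlonglongrightarrow> 0"

definition fourier ::
    "(real \<Rightarrow> 'e::{chilbert_space,second_countable_topology}) \<Rightarrow> real \<Rightarrow> 'e"
  where "fourier f = (SOME g. is_fourier f g)"

text \<open>
  \<open>dagger a b f\<close> is the extension \<open>u\<^sup>\<dagger>\<close> of \<open>u_tilde\<close> for \<open>b = \<beta>\<close>, and the extension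
  \<open>y\<^sup>\<dagger>\<close> of \<open>y_tilde\<close> for \<open>b = \<beta>\<^sub>*\<close>.
\<close>

definition dagger ::
    "('n::finite \<Rightarrow> 'e \<Rightarrow> 'e) \<Rightarrow> ('n \<Rightarrow> 'e \<Rightarrow> 'e)
      \<Rightarrow> (real \<Rightarrow> 'e::{chilbert_space,second_countable_topology}) \<Rightarrow> real ^ 'n::finite \<Rightarrow> 'e"
  where "dagger a b f t = (1 / sqrt (2 * pi)) *\<^sub>R
    (LINT s|lborel. expi (\<lambda>v. \<Sum>j\<in>UNIV. (t $ j) *\<^sub>R (s *\<^sub>R a j v + b j v)) (fourier f s))"

definition u_dagger ::
    "('h::{chilbert_space,second_countable_topology},
      'e::{chilbert_space,second_countable_topology}, 'n::{finite,one}) vessel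
      \<Rightarrow> ('h, 'e) kvec \<Rightarrow> real ^ 'n::{finite,one} \<Rightarrow> 'e"
  where "u_dagger V k = dagger (alpha V) (beta V) (u_tilde V k)"

definition y_dagger ::
    "('h::{chilbert_space,second_countable_topology},
      'e::{chilbert_space,second_countable_topology}, 'n::{finite,one}) vessel
      \<Rightarrow> ('h, 'e) kvec \<Rightarrow> real ^ 'n::{finite,one} \<Rightarrow> 'e"
  where "y_dagger V k = dagger (alpha V) (betas V) (y_tilde V k)"

text \<open>
  The path-independent line integral from \<open>0\<close> to \<open>t\<close> is taken along the segment
  \<open>s = r t\<close>, \<open>0 \<le> r \<le> 1\<close>, so that \<open>ds\<^sub>j = t\<^sub>j dr\<close>.
\<close>

definition x_traj ::
    "('h::{chilbert_space,second_countable_topology},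
      'e::{chilbert_space,second_countable_topology}, 'n::{finite,one}) vessel
      \<Rightarrow> ('h, 'e) kvec \<Rightarrow> real ^ 'n::{finite,one} \<Rightarrow> 'h"
  where "x_traj V k t =
    expi (\<lambda>v. \<Sum>j\<in>UNIV. (t $ j) *\<^sub>R opA V j v)
      (fst (snd k) - \<i> *\<^sub>C (LINT r:{0..1}|lborel.
         expi (\<lambda>v. - (\<Sum>j\<in>UNIV. ((r *\<^sub>R t) $ j) *\<^sub>R opA V j v))
           (cadjoint (Phi V) (\<Sum>j\<in>UNIV. (t $ j) *\<^sub>R sigma V j (u_dagger V k (r *\<^sub>R t))))))"

definition rho_smooth ::
    "('h::{chilbert_space,second_countable_topology},
      'e::{chilbert_space,second_countable_topology}, 'n::{finite,one}) vessel
      \<Rightarrow> real ^ 'n::{finite,one} \<Rightarrow> ('h, 'e) kvec \<Rightarrow> ('h, 'e) kvec"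
  where "rho_smooth V t k =
    ((\<lambda>s. y_dagger V k (t + axis 1 s)), x_traj V k t, (\<lambda>s. u_dagger V k (t + axis 1 s)))"

text \<open>
  \<open>\<rho>\<close> is the dilation constructed from \<open>V\<close>: the unitary representation whose operators
  \<open>\<rho>(t)\<close>, for \<open>t\<close> in \<open>Pos V \<union> - Pos V\<close>, extend the operators given by the formulas above on
  the dense subspace \<open>K_smooth V\<close>. These requirements determine \<open>\<rho>\<close> up to \<open>K_eq\<close>, since
  \<open>Pos V\<close> is a nonempty open cone and hence every \<open>t\<close> is a difference of two of its elements.
\<close>

definition dilation_of_vessel ::
    "('h::{chilbert_space,second_countable_topology},
      'e::{chilbert_space,second_countable_topology}, 'n::{finite,one}) vessel
      \<Rightarrow> (real ^ 'n::{finite,one} \<Rightarrow> ('h, 'e) kvec \<Rightarrow> ('h, 'e) kvec) \<Rightarrow> bool"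
  where "dilation_of_vessel V \<rho> \<longleftrightarrow>
    K_unitary_representation \<rho> \<and>
    (\<forall>t \<in> Pos V \<union> uminus ` Pos V. \<forall>k \<in> K_smooth V. K_eq (\<rho> t k) (rho_smooth V t k))"

end

theory Submission
  imports Defs "HOL-Probability.Sinc_Integral"
begin

text \<open>
  For \<open>v \<in> M\<close> and a scalar test function \<open>\<phi>\<close> put \<open>k = (\<phi> v, 0, \<phi> v)\<close>. Since \<open>\<Phi>\<^sup>* = \<Phi>\<^sup>* \<sigma>\<^sub>1\<close> vanishes
  on \<open>M\<close>, both \<open>u_tilde\<close> and \<open>y_tilde\<close> equal \<open>\<phi> v\<close>, and \<open>\<beta>\<^sub>*\<close> agrees with \<open>\<beta>\<close> on \<open>M\<close>. Hence
  \<open>u\<^sup>\<dagger>\<close> and \<open>y\<^sup>\<dagger>\<close> are \<open>M\<close>-valued and the trajectory \<open>x\<close> is zero: for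
  \<open>t \<in> Pos V \<union> - Pos V\<close> the vector \<open>\<rho>(t) k\<close> is \<open>M\<close>-valued with zero component in \<open>\<H>\<close>. By unitarity,
  if the function components of \<open>\<rho>(t) w\<close> are pointwise orthogonal to \<open>M\<close>, then \<open>w\<close> is orthogonal
  to all such \<open>k\<close>, and so its function components are pointwise orthogonal to \<open>M\<close> as well. Starting
  from \<open>h \<in> \<H>\<close> and using this step twice (every \<open>t\<close> is a difference of two elements of \<open>Pos V\<close>),
  the function components of every \<open>\<rho>(t) h\<close> are pointwise orthogonal to \<open>M\<close>, so no nonzero \<open>k\<close> is
  in the closed span.
\<close>

section \<open>Complex Hilbert spaces\<close>

context chilbert_space
begin

lemma scaleC_zero_right [simp]: "c *\<^sub>C (0::'a) = 0"
  using scaleC_add_right[of c 0 0] by simp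

lemma cinner_scaleC_right: "cinner x (c *\<^sub>C y) = cnj c * cinner x y"
  by (metis cinner_commute cinner_scaleC_left complex_cnj_mult)

lemma inner_scaleC_right: "inner x (c *\<^sub>C y) = inner (cnj c *\<^sub>C x) y"
  by (simp add: inner_eq_Re_cinner cinner_scaleC_left cinner_scaleC_right)

lemma scaleR_scaleC: "r *\<^sub>R (c *\<^sub>C x) = (of_real r * c) *\<^sub>C (x::'a)"
  by (metis scaleC_of_real scaleC_scaleC)

lemma scaleC_scaleR: "c *\<^sub>C (r *\<^sub>R x) = (of_real r * c) *\<^sub>C (x::'a)"
  by (metis scaleC_of_real scaleC_scaleC mult.commute)

end

lemma scaleC_zero_left [simp]: "0 *\<^sub>C (x::'a::chilbert_space) = 0"
  using scaleC_of_real[of 0 x] by simp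

lemma norm_scaleC: "norm (c *\<^sub>C x) = cmod c * norm (x::'a::chilbert_space)"
proof -
  have "(norm (c *\<^sub>C x))\<^sup>2 = Re ((c * cnj c) * cinner x x)"
    by (simp only: power2_norm_eq_inner inner_eq_Re_cinner cinner_scaleC_left cinner_scaleC_right
        mult_ac)
  also have "\<dots> = (cmod c * norm x)\<^sup>2"
    by (simp add: complex_norm_square[symmetric] power_mult_distrib power2_norm_eq_inner[of x]
        inner_eq_Re_cinner[of x] del: of_real_power)
  finally show ?thesis
    by (simp add: power2_eq_iff_nonneg)
qed

lemma bounded_linear_scaleC_right: "bounded_linear (\<lambda>x::'a::chilbert_space. c *\<^sub>C x)"
  by (rule bounded_linear_intro[where K = "cmod c"])
    (simp_all add: scaleC_add_right scaleC_scaleR scaleR_scaleC norm_scaleC mult.commute)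

lemma bounded_linear_scaleC_left: "bounded_linear (\<lambda>c. c *\<^sub>C (x::'a::chilbert_space))"
  by (rule bounded_linear_intro[where K = "norm x"])
    (simp_all add: scaleC_add_left scaleR_scaleC norm_scaleC scaleR_conv_of_real)

lemma scaleC_one: "1 *\<^sub>C x = (x::'a::chilbert_space)"
  using scaleC_of_real[of 1 x] by simp

lemma scaleC_minus_one: "(- 1) *\<^sub>C x = - (x::'a::chilbert_space)"
  using scaleC_of_real[of "-1" x] by simp

lemma norm_add_squared: "(norm (x + y))\<^sup>2 = (norm x)\<^sup>2 + (norm y)\<^sup>2 + 2 * inner x y"
  for x y :: "'a::real_inner"
  by (simp add: power2_norm_eq_inner inner_add_left inner_add_right inner_commute)

lemma norm_diff_squared: "(norm (x - y))\<^sup>2 = (norm x)\<^sup>2 + (norm y)\<^sup>2 - 2 * inner x y"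
  for x y :: "'a::real_inner"
  by (simp add: power2_norm_eq_inner inner_diff_left inner_diff_right inner_commute)

lemma abs_inner_le_sum_squares: "\<bar>inner x y\<bar> \<le> (norm x)\<^sup>2 + (norm y)\<^sup>2"
  for x y :: "'a::real_inner"
proof -
  have "2 * \<bar>inner x y\<bar> \<le> 2 * norm x * norm y"
    using Cauchy_Schwarz_ineq2[of x y] by simp
  also have "\<dots> \<le> (norm x)\<^sup>2 + (norm y)\<^sup>2"
    by (rule sum_squares_bound)
  finally show ?thesis
    by simp
qed

section \<open>Closed subspaces\<close>

lemma closed_csubspace_add: "closed_csubspace M \<Longrightarrow> x \<in> M \<Longrightarrow> y \<in> M \<Longrightarrow> x + y \<in> M"
  and closed_csubspace_zero: "closed_csubspace M \<Longrightarrow> 0 \<in> M"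
  and closed_csubspace_closed: "closed_csubspace M \<Longrightarrow> closed M"
  and closed_csubspace_scaleC: "closed_csubspace M \<Longrightarrow> x \<in> M \<Longrightarrow> c *\<^sub>C x \<in> M"
  by (auto simp: closed_csubspace_def)

lemma closed_csubspace_scaleR: "closed_csubspace M \<Longrightarrow> x \<in> M \<Longrightarrow> r *\<^sub>R x \<in> M"
  by (metis closed_csubspace_scaleC scaleC_of_real)

lemma closed_csubspace_subspace: "closed_csubspace M \<Longrightarrow> subspace M"
  by (simp add: subspace_def closed_csubspace_add closed_csubspace_zero closed_csubspace_scaleR)

text \<open>The parallelogram law makes every sequence in \<open>M\<close> that minimizes the
  distance to \<open>x\<close> a Cauchy sequence. Completeness provides its limit, and closedness of
  \<open>M\<close> keeps the limit in \<open>M\<close>.\<close>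

lemma nearest_point_subspace:
  fixes M :: "'a::{real_inner,banach} set"
  assumes M: "subspace M" "closed M"
  obtains m where "m \<in> M" "\<And>m'. m' \<in> M \<Longrightarrow> norm (x - m) \<le> norm (x - m')"
proof -
  define d where "d = infdist x M"
  have ne: "M \<noteq> {}"
    using subspace_0[OF M(1)] by auto
  have d_le: "d \<le> norm (x - m)" if "m \<in> M" for m
    using infdist_le[OF that, of x] by (simp add: d_def dist_norm)
  have d0: "0 \<le> d"
    by (simp add: d_def infdist_nonneg)
  have "\<exists>m\<in>M. (norm (x - m))\<^sup>2 < d\<^sup>2 + inverse (real (Suc n))" for n
  proof -
    have "d < sqrt (d\<^sup>2 + inverse (real (Suc n)))"
      by (rule real_less_rsqrt) simp
    then have "(INF m\<in>M. dist x m) < sqrt (d\<^sup>2 + inverse (real (Suc n)))"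
      by (simp add: d_def infdist_notempty[OF ne])
    then obtain m where m: "m \<in> M" "dist x m < sqrt (d\<^sup>2 + inverse (real (Suc n)))"
      by (auto dest!: cInf_lessD[rotated] simp: ne)
    then have "(norm (x - m))\<^sup>2 < (sqrt (d\<^sup>2 + inverse (real (Suc n))))\<^sup>2"
      by (intro power_strict_mono) (simp_all add: dist_norm)
    then show ?thesis
      using m(1) by (auto intro!: bexI[of _ m])
  qed
  then obtain f where fM: "\<And>n. f n \<in> M"
    and f: "\<And>n. (norm (x - f n))\<^sup>2 < d\<^sup>2 + inverse (real (Suc n))"
    by metis
  \<comment> \<open>The midpoint of \<open>f i\<close> and \<open>f j\<close> lies in
    \<open>M\<close>, so its distance to \<open>x\<close> is at least \<open>d\<close>. In the
    parallelogram identity this bounds the remaining diagonal.\<close>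
  have close: "(norm (f i - f j))\<^sup>2 < 2 * inverse (real (Suc i)) + 2 * inverse (real (Suc j))" for i j
  proof -
    define m where "m = (1/2) *\<^sub>R (f i + f j)"
    have "m \<in> M"
      unfolding m_def by (intro subspace_scale subspace_add M fM)
    then have "d\<^sup>2 \<le> (norm (x - m))\<^sup>2"
      using d_le d0 by (simp add: power_mono)
    moreover have "(norm (f i - f j))\<^sup>2 =
        2 * (norm (x - f i))\<^sup>2 + 2 * (norm (x - f j))\<^sup>2 - 4 * (norm (x - m))\<^sup>2"
      unfolding m_def power2_norm_eq_inner
      by (simp add: inner_diff_left inner_diff_right inner_add_left inner_add_right
          inner_commute field_simps)
    ultimately show ?thesis
      using f[of i] f[of j] by linarith
  qed
  have "Cauchy f"
  proof (rule metric_CauchyI)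
    fix e :: real assume e: "e > 0"
    then obtain N where N: "inverse (real (Suc N)) < e\<^sup>2 / 4"
      using reals_Archimedean[of "e\<^sup>2 / 4"] by auto
    have "dist (f i) (f j) < e" if "i \<ge> N" "j \<ge> N" for i j
    proof -
      have "inverse (real (Suc i)) \<le> inverse (real (Suc N))"
        "inverse (real (Suc j)) \<le> inverse (real (Suc N))"
        using that by (simp_all add: field_simps)
      then have "(norm (f i - f j))\<^sup>2 < e\<^sup>2"
        using close[of i j] N by linarith
      then show ?thesis
        using e by (simp add: dist_norm power_less_imp_less_base)
    qed
    then show "\<exists>N. \<forall>i\<ge>N. \<forall>j\<ge>N. dist (f i) (f j) < e"
      by blast
  qed
  then obtain m where m: "f \<longlonglongrightarrow> m"
    using Cauchy_convergent convergent_def by blast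
  have mM: "m \<in> M"
    using closed_sequentially[OF M(2) _ m] fM by blast
  have "(norm (x - m))\<^sup>2 \<le> d\<^sup>2"
  proof (rule LIMSEQ_le)
    show "(\<lambda>n. (norm (x - f n))\<^sup>2) \<longlonglongrightarrow> (norm (x - m))\<^sup>2"
      by (intro tendsto_intros m)
    show "(\<lambda>n. d\<^sup>2 + inverse (real (Suc n))) \<longlonglongrightarrow> d\<^sup>2"
      using tendsto_add[OF tendsto_const LIMSEQ_inverse_real_of_nat] by simp
    show "\<exists>N. \<forall>n\<ge>N. (norm (x - f n))\<^sup>2 \<le> d\<^sup>2 + inverse (real (Suc n))"
      using f less_imp_le by blast
  qed
  then have "norm (x - m) \<le> d"
    using d0 power2_le_imp_le by blast
  then show thesis
    using that[OF mM] d_le by (meson order_trans)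
qed

text \<open>The separating vector is the residual \<open>x - m\<close> for the point
  \<open>m\<close> of \<open>M\<close> nearest to \<open>x\<close>: a nonzero component along some
  \<open>m'\<close> in \<open>M\<close> would allow a point closer than \<open>m\<close>.\<close>

lemma separate_point_subspace:
  fixes M :: "'a::{real_inner,banach} set"
  assumes M: "subspace M" "closed M" and x: "x \<notin> M"
  obtains w where "\<And>m. m \<in> M \<Longrightarrow> inner m w = 0" "inner x w \<noteq> 0"
proof -
  obtain m where m: "m \<in> M" and le: "\<And>m'. m' \<in> M \<Longrightarrow> norm (x - m) \<le> norm (x - m')"
    using nearest_point_subspace[OF M] by blast
  define w where "w = x - m"
  have orth: "inner m' w = 0" if m': "m' \<in> M" for m'
  proof (cases "m' = 0")
    case False
    \<comment> \<open>This \<open>r\<close> minimizes the quadratic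
      \<open>norm (w - r *\<^sub>R m')\<close> squared; the gain at the minimum is the square that
      is then forced to vanish.\<close>
    define r where "r = inner m' w / (norm m')\<^sup>2"
    have "(norm w)\<^sup>2 \<le> (norm (w - r *\<^sub>R m'))\<^sup>2"
      using le[of "m + r *\<^sub>R m'"] M m m'
      by (simp add: w_def subspace_add subspace_scale power_mono algebra_simps)
    also have "\<dots> = (norm w)\<^sup>2 - 2 * r * inner m' w + r\<^sup>2 * (norm m')\<^sup>2"
      unfolding power2_norm_eq_inner
      by (simp add: inner_diff_left inner_diff_right inner_commute power2_eq_square algebra_simps)
    also have "\<dots> = (norm w)\<^sup>2 - (inner m' w)\<^sup>2 / (norm m')\<^sup>2"
      using False by (simp add: r_def power2_eq_square field_simps)
    finally have "(inner m' w)\<^sup>2 / (norm m')\<^sup>2 \<le> 0"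
      by simp
    then show ?thesis
      using False by (simp add: divide_le_0_iff)
  qed simp
  have "inner x w = inner w w"
    using orth[OF m] by (simp add: w_def inner_diff_left)
  moreover have "w \<noteq> 0"
    using x m by (auto simp: w_def)
  ultimately show thesis
    using that[OF orth] by simp
qed

text \<open>A functional that vanishes on \<open>M\<close> commutes with the integral, so it cannot
  separate the integral from \<open>M\<close>.\<close>

lemma integral_in_closed_subspace:
  fixes M :: "'a::{real_inner,banach,second_countable_topology} set"
  assumes M: "subspace M" "closed M" and f: "AE x in N. f x \<in> M"
  shows "(\<integral>x. f x \<partial>N) \<in> M"
proof (rule ccontr)
  assume not_in: "(\<integral>x. f x \<partial>N) \<notin> M"
  \<comment> \<open>The integral of a non-integrable function is 0 by convention, and 0 lies in
    \<open>M\<close>; an integral outside \<open>M\<close> therefore comes from an integrable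
    \<open>f\<close>.\<close>
  then have int: "integrable N f"
    using subspace_0[OF M(1)] not_integrable_integral_eq by metis
  obtain w where w: "\<And>m. m \<in> M \<Longrightarrow> inner m w = 0" "inner (\<integral>x. f x \<partial>N) w \<noteq> 0"
    using separate_point_subspace[OF M not_in] by blast
  have "inner (\<integral>x. f x \<partial>N) w = (\<integral>x. inner (f x) w \<partial>N)"
    using integral_bounded_linear[OF bounded_linear_inner_left int] by simp
  also have "\<dots> = 0"
    by (rule integral_eq_zero_AE) (use f in \<open>eventually_elim, simp add: w\<close>)
  finally show False
    using w(2) by simp
qed

section \<open>Operator exponentials on closed invariant subspaces\<close>

lemma summable_expi:
  fixes T :: "'a::chilbert_space \<Rightarrow> 'a"
  assumes "bounded_linear T"
  shows "summable (\<lambda>n. (\<i> ^ n / fact n) *\<^sub>C (T ^^ n) v)"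
proof -
  obtain B where B: "0 \<le> B" "\<And>x. norm (T x) \<le> norm x * B"
    using bounded_linear.nonneg_bounded[OF assms] by blast
  have pow: "norm ((T ^^ n) v) \<le> B ^ n * norm v" for n
  proof (induction n)
    case (Suc n)
    have "norm (T ((T ^^ n) v)) \<le> norm ((T ^^ n) v) * B"
      by (rule B)
    also have "\<dots> \<le> B ^ n * norm v * B"
      by (rule mult_right_mono[OF Suc B(1)])
    finally show ?case
      by (simp add: mult_ac)
  qed simp
  show ?thesis
  proof (rule summable_comparison_test')
    show "summable (\<lambda>n. norm v * (B ^ n /\<^sub>R fact n))"
      by (intro summable_mult summable_exp_generic)
    show "norm ((\<i> ^ n / fact n) *\<^sub>C (T ^^ n) v) \<le> norm v * (B ^ n /\<^sub>R fact n)" for n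
      using pow[of n] by (simp add: norm_scaleC norm_divide norm_power field_simps)
  qed
qed

lemma expi_in_closed_csubspace:
  assumes M: "closed_csubspace M" and T: "bounded_linear T" "T ` M \<subseteq> M" and v: "v \<in> M"
  shows "expi T v \<in> M"
proof -
  have "(T ^^ n) v \<in> M" for n
    using T(2) v by (induction n) auto
  then have part: "(\<Sum>i<n. (\<i> ^ i / fact i) *\<^sub>C (T ^^ i) v) \<in> M" for n
    by (intro subspace_sum closed_csubspace_subspace closed_csubspace_scaleC M)
  show ?thesis
    unfolding expi_def
    by (rule closed_sequentially[OF closed_csubspace_closed[OF M] _
          summable_LIMSEQ[OF summable_expi[OF T(1)]]]) (rule part)
qed

text \<open>Linearity is not assumed, because \<open>T\<close> will also be built from
  \<open>cadjoint (opA V 1)\<close>, an operator obtained by choice, of which only the value at 0 is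
  computed.\<close>

lemma expi_zero: "T 0 = 0 \<Longrightarrow> expi T 0 = 0"
proof -
  assume "T 0 = 0"
  then have "(T ^^ n) 0 = 0" for n
    by (induction n) auto
  then show ?thesis
    by (simp add: expi_def)
qed

section \<open>Test functions and their Fourier transforms\<close>

text \<open>The radius \<open>R\<close> is explicit because the truncated integrals in
  \<open>is_fourier\<close> are constant in \<open>n\<close> as soon as
  \<open>R \<le> real n\<close>.\<close>

definition C2_supported_in :: "real \<Rightarrow> (real \<Rightarrow> real) \<Rightarrow> bool"
  where "C2_supported_in R \<phi> \<longleftrightarrow> (\<exists>\<phi>' \<phi>''.
    (\<forall>t. (\<phi> has_real_derivative \<phi>' t) (at t)) \<and>
    (\<forall>t. (\<phi>' has_real_derivative \<phi>'' t) (at t)) \<and>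
    continuous_on UNIV \<phi>'' \<and> (\<forall>t. R < \<bar>t\<bar> \<longrightarrow> \<phi> t = 0))"

lemma derivative_zero_off_support:
  fixes \<phi> :: "real \<Rightarrow> real"
  assumes "(\<phi> has_real_derivative D) (at t)" "\<And>t. R < \<bar>t\<bar> \<Longrightarrow> \<phi> t = 0" "R < \<bar>t\<bar>"
  shows "D = 0"
proof -
  have "((\<lambda>t. 0) has_real_derivative D) (at t)"
    by (rule has_field_derivative_transform_within_open[OF assms(1), of "{t. R < \<bar>t\<bar>}"])
      (use assms in \<open>auto intro!: open_Collect_less continuous_intros\<close>)
  then show ?thesis
    using DERIV_unique DERIV_const by blast
qed

lemma integrable_compact_support:
  fixes f :: "real \<Rightarrow> 'a::{banach,second_countable_topology}"
  assumes "continuous_on UNIV f" "\<And>t. R < \<bar>t\<bar> \<Longrightarrow> f t = 0"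
  shows "integrable lborel f"
proof -
  have "integrable lborel (\<lambda>t. indicator {-R..R} t *\<^sub>R f t)"
    using assms(1) by (intro borel_integrable_compact) (auto intro: continuous_on_subset)
  moreover have "(\<lambda>t. indicator {-R..R} t *\<^sub>R f t) = f"
    using assms(2) by (auto simp: fun_eq_iff indicator_def)
  ultimately show ?thesis
    by simp
qed

lemma square_integrable_compact_support:
  fixes f :: "real \<Rightarrow> 'a::{chilbert_space,second_countable_topology}"
  assumes "continuous_on UNIV f" "\<And>t. R < \<bar>t\<bar> \<Longrightarrow> f t = 0" "S \<in> sets borel"
  shows "square_integrable S f"
proof -
  have "integrable lborel (\<lambda>t. (norm (f t))\<^sup>2)"
    using assms by (intro integrable_compact_support[where R = R]) (auto intro!: continuous_intros)
  moreover have "f \<in> borel_measurable borel"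
    using assms(1) by (rule borel_measurable_continuous_onI)
  ultimately show ?thesis
    using assms(3) integrable_mult_indicator[of S lborel "\<lambda>t. (norm (f t))\<^sup>2"]
    by (simp add: square_integrable_def set_borel_measurable_def set_integrable_def)
qed

lemma C2_supported_in_continuous: "C2_supported_in R \<phi> \<Longrightarrow> continuous_on UNIV \<phi>"
  unfolding C2_supported_in_def by (blast intro: DERIV_isCont continuous_at_imp_continuous_on)

lemma C2_supported_in_zero: "C2_supported_in R \<phi> \<Longrightarrow> R < \<bar>t\<bar> \<Longrightarrow> \<phi> t = 0"
  by (auto simp: C2_supported_in_def)

lemma square_integrable_test:
  fixes v :: "'a::{chilbert_space,second_countable_topology}"
  assumes "C2_supported_in R \<phi>" "S \<in> sets borel"
  shows "square_integrable S (\<lambda>t. \<phi> t *\<^sub>R v)"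
  by (rule square_integrable_compact_support[where R = R])
    (use assms in \<open>auto simp: C2_supported_in_zero
      intro!: continuous_intros C2_supported_in_continuous\<close>)

text \<open>The function serves as its own smooth representative. Both derivatives vanish off the
  support of \<open>\<phi>\<close>, hence are continuous with compact support and square
  integrable.\<close>

lemma twice_C_L2_test:
  fixes v :: "'a::{chilbert_space,second_countable_topology}"
  assumes "C2_supported_in R \<phi>"
  shows "twice_C_L2 (\<lambda>t. \<phi> t *\<^sub>R v)"
proof -
  obtain \<phi>' \<phi>'' where d: "\<And>t. (\<phi> has_real_derivative \<phi>' t) (at t)"
    "\<And>t. (\<phi>' has_real_derivative \<phi>'' t) (at t)" "continuous_on UNIV \<phi>''"
    and z: "\<And>t. R < \<bar>t\<bar> \<Longrightarrow> \<phi> t = 0"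
    using assms by (auto simp: C2_supported_in_def)
  have z': "\<phi>' t = 0" if "R < \<bar>t\<bar>" for t
    by (rule derivative_zero_off_support[OF d(1) z that])
  have z'': "\<phi>'' t = 0" if "R < \<bar>t\<bar>" for t
    by (rule derivative_zero_off_support[OF d(2) z' that])
  have c': "continuous_on UNIV \<phi>'"
    by (intro continuous_at_imp_continuous_on ballI DERIV_isCont[OF d(2)])
  have vd: "((\<lambda>t. \<psi> t *\<^sub>R v) has_vector_derivative D *\<^sub>R v) (at t)"
    if "(\<psi> has_real_derivative D) (at t)" for \<psi> D t
    using has_vector_derivative_scaleR[OF that has_vector_derivative_const[of v]] by simp
  show ?thesis
    unfolding twice_C_L2_def
    by (intro exI[of _ "\<lambda>t. \<phi> t *\<^sub>R v"] exI[of _ "\<lambda>t. \<phi>' t *\<^sub>R v"] exI[of _ "\<lambda>t. \<phi>'' t *\<^sub>R v"] conjI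
        allI vd d square_integrable_compact_support[where R = R])
      (auto simp: z' z'' intro!: continuous_intros c' d)
qed

section \<open>Measurability and decay of Fourier integrals of test functions\<close>

lemma borel_measurable_fourier_integral:
  assumes "continuous_on UNIV \<phi>"
  shows "(\<lambda>s. \<integral>t. cis (- (s * t)) * complex_of_real (\<phi> t) \<partial>lborel) \<in> borel_measurable borel"
proof -
  have [measurable]: "\<phi> \<in> borel_measurable borel"
    using assms by (rule borel_measurable_continuous_onI)
  have [measurable]: "cis \<in> borel_measurable borel"
    by (intro borel_measurable_continuous_onI continuous_intros)
  show ?thesis
    by measurable
qed

lemma cis_has_vector_derivative:
  "((\<lambda>t. cis (- (s * t))) has_vector_derivative - (\<i> * of_real s) * cis (- (s * t))) (at t)"
proof -
  have "((\<lambda>z. exp (- (\<i> * of_real s) * z)) has_field_derivative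
      - (\<i> * of_real s) * exp (- (\<i> * of_real s) * of_real t)) (at (of_real t))"
    by (auto intro!: derivative_eq_intros)
  from has_vector_derivative_real_field[OF this] show ?thesis
    by (simp add: cis_conv_exp mult_ac)
qed

text \<open>Integration by parts: the Fourier integral of \<open>\<phi>'\<close> is
  \<open>\<i> * s\<close> times that of \<open>\<phi>\<close>, and it is bounded by the integral of
  the absolute value of \<open>\<phi>'\<close>.\<close>

lemma fourier_integral_decay:
  assumes d: "\<And>t. (\<phi> has_real_derivative \<phi>' t) (at t)" and c': "continuous_on UNIV \<phi>'"
    and z: "\<And>t. R < \<bar>t\<bar> \<Longrightarrow> \<phi> t = 0"
  shows "\<bar>s\<bar> * cmod (\<integral>t. cis (- (s * t)) * complex_of_real (\<phi> t) \<partial>lborel)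
    \<le> (\<integral>t. \<bar>\<phi>' t\<bar> \<partial>lborel)"
proof -
  have c: "continuous_on UNIV \<phi>"
    by (intro continuous_at_imp_continuous_on ballI DERIV_isCont[OF d])
  have z': "\<phi>' t = 0" if "R < \<bar>t\<bar>" for t
    by (rule derivative_zero_off_support[OF d z that])
  have ci: "continuous_on UNIV (\<lambda>t. cis (- (s * t)) * complex_of_real (\<psi> t))"
    if "continuous_on UNIV \<psi>" for \<psi>
    using that by (intro continuous_intros)
  have int: "integrable lborel (\<lambda>t. cis (- (s * t)) * complex_of_real (\<phi> t))"
    by (rule integrable_compact_support[OF ci[OF c], of R]) (simp add: z)
  have int': "integrable lborel (\<lambda>t. cis (- (s * t)) * complex_of_real (\<phi>' t))"
    by (rule integrable_compact_support[OF ci[OF c'], of R]) (simp add: z')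
  \<comment> \<open>\<open>h\<close> is the derivative in \<open>t\<close> of
    \<open>cis (- (s * t)) * \<phi> t\<close>, so its integral is a difference of boundary
    values.\<close>
  define h where "h = (\<lambda>t. cis (- (s * t)) * complex_of_real (\<phi>' t)
    - \<i> * of_real s * (cis (- (s * t)) * complex_of_real (\<phi> t)))"
  \<comment> \<open>The choice makes \<open>b\<close> positive and larger than \<open>R\<close>,
    whatever the sign of \<open>R\<close>, so \<open>\<phi>\<close> vanishes at both end
    points.\<close>
  define b where "b = \<bar>R\<bar> + 1"
  have "(\<integral>t. indicator {-b..b} t *\<^sub>R h t \<partial>lborel)
      = cis (- (s * b)) * complex_of_real (\<phi> b) - cis (- (s * -b)) * complex_of_real (\<phi> (-b))"
  proof (rule integral_FTC_atLeastAtMost)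
    show "((\<lambda>t. cis (- (s * t)) * complex_of_real (\<phi> t)) has_vector_derivative h t)
        (at t within {-b..b})" for t
    proof -
      have "((\<lambda>t. complex_of_real (\<phi> t)) has_vector_derivative of_real (\<phi>' t)) (at t)"
        by (intro has_vector_derivative_of_real d)
      from has_vector_derivative_mult[OF cis_has_vector_derivative[of s t] this] show ?thesis
        by (rule has_vector_derivative_at_within[THEN has_vector_derivative_eq_rhs])
          (simp add: h_def algebra_simps)
    qed
    show "continuous_on {-b..b} h"
      unfolding h_def
      by (intro continuous_on_diff continuous_on_mult continuous_on_const
          continuous_on_subset[OF ci[OF c]] continuous_on_subset[OF ci[OF c']]) auto
  qed (simp add: b_def)
  also have "\<dots> = 0"
    by (simp add: z b_def)
  also have "(\<lambda>t. indicator {-b..b} t *\<^sub>R h t) = h"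
    by (auto simp: fun_eq_iff indicator_def h_def b_def z z')
  finally have "(\<integral>t. h t \<partial>lborel) = 0" .
  then have eq: "(\<integral>t. cis (- (s * t)) * complex_of_real (\<phi>' t) \<partial>lborel)
      = \<i> * of_real s * (\<integral>t. cis (- (s * t)) * complex_of_real (\<phi> t) \<partial>lborel)"
    using int int' by (simp add: h_def)
  have "\<bar>s\<bar> * cmod (\<integral>t. cis (- (s * t)) * complex_of_real (\<phi> t) \<partial>lborel)
      = cmod (\<integral>t. cis (- (s * t)) * complex_of_real (\<phi>' t) \<partial>lborel)"
    by (simp add: eq norm_mult)
  also have "\<dots> \<le> (\<integral>t. norm (cis (- (s * t)) * complex_of_real (\<phi>' t)) \<partial>lborel)"
    by (rule integral_norm_bound)
  finally show ?thesis
    by (simp add: norm_mult)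
qed

text \<open>The uniform bound \<open>K\<close> and the decay bound \<open>K'\<close> combine, after
  squaring and adding, into a multiple of \<open>inverse (1 + s\<^sup>2)\<close>, which is
  integrable.\<close>

lemma square_integrable_fourier_integral:
  assumes "C2_supported_in R \<phi>"
  shows "integrable lborel
    (\<lambda>s. (cmod (\<integral>t. cis (- (s * t)) * complex_of_real (\<phi> t) \<partial>lborel))\<^sup>2)"
proof -
  obtain \<phi>' \<phi>'' where d: "\<And>t. (\<phi> has_real_derivative \<phi>' t) (at t)"
    "\<And>t. (\<phi>' has_real_derivative \<phi>'' t) (at t)" "continuous_on UNIV \<phi>''"
    and z: "\<And>t. R < \<bar>t\<bar> \<Longrightarrow> \<phi> t = 0"
    using assms by (auto simp: C2_supported_in_def)
  have c': "continuous_on UNIV \<phi>'"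
    by (intro continuous_at_imp_continuous_on ballI DERIV_isCont[OF d(2)])
  define c where "c s = (\<integral>t. cis (- (s * t)) * complex_of_real (\<phi> t) \<partial>lborel)" for s
  define K where "K = (\<integral>t. \<bar>\<phi> t\<bar> \<partial>lborel)"
  define K' where "K' = (\<integral>t. \<bar>\<phi>' t\<bar> \<partial>lborel)"
  have K: "cmod (c s) \<le> K" for s
    using integral_norm_bound[of lborel "\<lambda>t. cis (- (s * t)) * complex_of_real (\<phi> t)"]
    by (simp add: c_def K_def norm_mult)
  have K': "\<bar>s\<bar> * cmod (c s) \<le> K'" for s
    unfolding c_def K'_def by (rule fourier_integral_decay[OF d(1) c' z])
  have bound: "(cmod (c s))\<^sup>2 \<le> (K\<^sup>2 + K'\<^sup>2) * inverse (1 + s\<^sup>2)" for s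
  proof -
    have "(cmod (c s))\<^sup>2 \<le> K\<^sup>2" "(\<bar>s\<bar> * cmod (c s))\<^sup>2 \<le> K'\<^sup>2"
      by (rule power_mono[OF K] power_mono[OF K'], simp)+
    then have "(cmod (c s))\<^sup>2 * (1 + s\<^sup>2) \<le> K\<^sup>2 + K'\<^sup>2"
      by (simp add: power_mult_distrib algebra_simps)
    moreover have "0 < 1 + s\<^sup>2"
      by (simp add: add_pos_nonneg)
    ultimately show ?thesis
      by (simp add: divide_inverse[symmetric] pos_le_divide_eq)
  qed
  have "integrable lborel (\<lambda>s::real. inverse (1 + s\<^sup>2))"
    using integrable_inverse_1_plus_square by (simp add: set_integrable_def einterval_eq)
  then have "integrable lborel (\<lambda>s. (K\<^sup>2 + K'\<^sup>2) * inverse (1 + s\<^sup>2))"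
    by (rule integrable_mult_right)
  moreover have "c \<in> borel_measurable borel"
    unfolding c_def using assms
    by (intro borel_measurable_fourier_integral C2_supported_in_continuous)
  then have "(\<lambda>s. (cmod (c s))\<^sup>2) \<in> borel_measurable lborel"
    by simp
  ultimately have "integrable lborel (\<lambda>s. (cmod (c s))\<^sup>2)"
  proof (rule Bochner_Integration.integrable_bound)
    have "norm ((cmod (c s))\<^sup>2) \<le> norm ((K\<^sup>2 + K'\<^sup>2) * inverse (1 + s\<^sup>2))" for s
      using order_trans[OF bound[of s] abs_ge_self] by (simp only: real_norm_def abs_power2)
    then show "AE s in lborel. norm ((cmod (c s))\<^sup>2)
        \<le> norm ((K\<^sup>2 + K'\<^sup>2) * inverse (1 + s\<^sup>2))"
      by (rule AE_I2)
  qed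
  then show ?thesis
    by (simp add: c_def)
qed

text \<open>Compact support makes the truncated integrals eventually equal to the explicit function
  \<open>G\<close>, so the limit in the definition is that of a sequence that is eventually 0. The
  values of \<open>G\<close> are scalar multiples of \<open>v\<close>.\<close>

lemma is_fourier_test:
  fixes v :: "'a::{chilbert_space,second_countable_topology}"
  assumes \<phi>: "C2_supported_in R \<phi>"
  defines "c \<equiv> \<lambda>s. \<integral>t. cis (- (s * t)) * complex_of_real (\<phi> t) \<partial>lborel"
  defines "G \<equiv> \<lambda>s. (1 / sqrt (2 * pi)) *\<^sub>R (c s *\<^sub>C v)"
  shows truncated_fourier_test: "\<And>n::nat. R \<le> real n \<Longrightarrow> (1 / sqrt (2 * pi)) *\<^sub>R
        (LINT t:{- real n..real n}|lborel. cis (- (s * t)) *\<^sub>C (\<phi> t *\<^sub>R v)) = G s"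
    and "is_fourier (\<lambda>t. \<phi> t *\<^sub>R v) G"
proof -
  have c: "continuous_on UNIV \<phi>"
    using \<phi> by (rule C2_supported_in_continuous)
  have int: "integrable lborel (\<lambda>t. cis (- (s * t)) * complex_of_real (\<phi> t))" for s
    by (rule integrable_compact_support[of _ R])
      (auto intro!: continuous_intros c simp: C2_supported_in_zero[OF \<phi>])
  show trunc: "(1 / sqrt (2 * pi)) *\<^sub>R
        (LINT t:{- real n..real n}|lborel. cis (- (s * t)) *\<^sub>C (\<phi> t *\<^sub>R v)) = G s"
    if "R \<le> real n" for n :: nat and s
  proof -
    have "indicator {- real n..real n} t *\<^sub>R cis (- (s * t)) *\<^sub>C (\<phi> t *\<^sub>R v)
        = (cis (- (s * t)) * complex_of_real (\<phi> t)) *\<^sub>C v" for t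
    proof (cases "t \<in> {- real n..real n}")
      case False
      then have "\<phi> t = 0"
        using that by (intro C2_supported_in_zero[OF \<phi>]) auto
      then show ?thesis
        by simp
    qed (simp add: scaleC_scaleR mult.commute)
    then show ?thesis
      using integral_bounded_linear[OF bounded_linear_scaleC_left[of v] int[of s]]
      by (simp add: set_lebesgue_integral_def G_def c_def)
  qed
  have "c \<in> borel_measurable borel"
    unfolding c_def using c by (rule borel_measurable_fourier_integral)
  then have G_meas: "G \<in> borel_measurable borel"
    unfolding G_def
    by (intro borel_measurable_scaleR borel_measurable_const
        measurable_compose[OF _ borel_measurable_continuous_onI[OF
          linear_continuous_on[OF bounded_linear_scaleC_left]]])
  have "integrable lborel (\<lambda>s. ((1 / sqrt (2 * pi)) * norm v)\<^sup>2 * (cmod (c s))\<^sup>2)"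
    unfolding c_def by (intro integrable_mult_right square_integrable_fourier_integral[OF \<phi>])
  then have "square_integrable UNIV G"
    using G_meas by (simp add: square_integrable_def set_borel_measurable_def set_integrable_def
        G_def norm_scaleC power_mult_distrib power_divide mult_ac)
  moreover have "(\<lambda>n::nat. \<integral>\<^sup>+ s. ennreal ((norm (G s - (1 / sqrt (2 * pi)) *\<^sub>R
        (LINT t:{- real n..real n}|lborel. cis (- (s * t)) *\<^sub>C (\<phi> t *\<^sub>R v))))\<^sup>2) \<partial>lborel)
      \<longlonglongrightarrow> 0"
  proof (rule tendsto_eventually)
    obtain N :: nat where "R \<le> real N"
      using real_arch_simple by blast
    then show "\<forall>\<^sub>F n::nat in sequentially. (\<integral>\<^sup>+ s. ennreal ((norm (G s - (1 / sqrt (2 * pi)) *\<^sub>R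
        (LINT t:{- real n..real n}|lborel. cis (- (s * t)) *\<^sub>C (\<phi> t *\<^sub>R v))))\<^sup>2) \<partial>lborel) = 0"
      unfolding eventually_sequentially
      by (intro exI[of _ N] allI impI) (simp add: trunc)
  qed
  ultimately show "is_fourier (\<lambda>t. \<phi> t *\<^sub>R v) G"
    unfolding is_fourier_def by blast
qed

text \<open>\<open>fourier\<close> selects some transform \<open>g\<close>, possibly different from
  the explicit \<open>G\<close>. The two agree almost everywhere, and \<open>G\<close> takes values
  in the complex line through \<open>v\<close>.\<close>

lemma fourier_test_in_closed_csubspace:
  fixes v :: "'a::{chilbert_space,second_countable_topology}"
  assumes \<phi>: "C2_supported_in R \<phi>" and M: "closed_csubspace M" "v \<in> M"
  shows "AE s in lborel. fourier (\<lambda>t. \<phi> t *\<^sub>R v) s \<in> M"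
proof -
  define G where "G s = (1 / sqrt (2 * pi)) *\<^sub>R
    ((\<integral>t. cis (- (s * t)) * complex_of_real (\<phi> t) \<partial>lborel) *\<^sub>C v)" for s
  define g where "g = fourier (\<lambda>t. \<phi> t *\<^sub>R v)"
  have isG: "is_fourier (\<lambda>t. \<phi> t *\<^sub>R v) G"
    unfolding G_def by (rule is_fourier_test[OF \<phi>])
  have isg: "is_fourier (\<lambda>t. \<phi> t *\<^sub>R v) g"
    unfolding g_def fourier_def by (rule someI[of "is_fourier _", OF isG])
  have meas[measurable]: "g \<in> borel_measurable borel" "G \<in> borel_measurable borel"
    using isG isg
    by (simp_all add: is_fourier_def square_integrable_def set_borel_measurable_def)
  obtain N :: nat where N: "R \<le> real N"
    using real_arch_simple by blast
  have "(\<lambda>n::nat. \<integral>\<^sup>+ s. ennreal ((norm (g s - G s))\<^sup>2) \<partial>lborel) \<longlonglongrightarrow> 0"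
  proof (rule Lim_transform_eventually)
    show "(\<lambda>n::nat. \<integral>\<^sup>+ s. ennreal ((norm (g s - (1 / sqrt (2 * pi)) *\<^sub>R
        (LINT t:{- real n..real n}|lborel. cis (- (s * t)) *\<^sub>C (\<phi> t *\<^sub>R v))))\<^sup>2) \<partial>lborel)
      \<longlonglongrightarrow> 0"
      using isg by (simp add: is_fourier_def)
    show "\<forall>\<^sub>F n::nat in sequentially. (\<integral>\<^sup>+ s. ennreal ((norm (g s - (1 / sqrt (2 * pi)) *\<^sub>R
        (LINT t:{- real n..real n}|lborel. cis (- (s * t)) *\<^sub>C (\<phi> t *\<^sub>R v))))\<^sup>2) \<partial>lborel)
        = (\<integral>\<^sup>+ s. ennreal ((norm (g s - G s))\<^sup>2) \<partial>lborel)"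
      unfolding eventually_sequentially
      by (intro exI[of _ N] allI impI) (use N in \<open>simp add: truncated_fourier_test[OF \<phi>] G_def\<close>)
  qed
  \<comment> \<open>The sequence is constant in \<open>n\<close>, so convergence to 0 means that the
    constant is 0.\<close>
  then have "(\<integral>\<^sup>+ s. ennreal ((norm (g s - G s))\<^sup>2) \<partial>lborel) = 0"
    by (simp add: LIMSEQ_const_iff)
  then have "AE s in lborel. ennreal ((norm (g s - G s))\<^sup>2) = 0"
    by (subst (asm) nn_integral_0_iff_AE) auto
  then show ?thesis
    unfolding g_def[symmetric]
  proof eventually_elim
    case (elim s)
    then have "g s = G s"
      by simp
    then show ?case
      by (simp add: G_def M closed_csubspace_scaleC closed_csubspace_scaleR)
  qed
qed

section \<open>Locally integrable functions are determined by test functions\<close>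

text \<open>Away from 0 the function is locally either 0 or a monomial. At 0 the exponent is at
  least 2, so the one-sided slopes both vanish.\<close>

lemma max_zero_power_has_derivative:
  "((\<lambda>x::real. (max 0 x) ^ Suc (Suc k)) has_real_derivative
    real (Suc (Suc k)) * (max 0 x) ^ Suc k) (at x)"
proof -
  consider "x < 0" | "x = 0" | "x > 0"
    by linarith
  then show ?thesis
  proof cases
    case 1
    then have "((\<lambda>x. 0) has_real_derivative real (Suc (Suc k)) * (max 0 x) ^ Suc k) (at x)"
      by simp
    then show ?thesis
      by (rule has_field_derivative_transform_within_open[where S = "{..<0}"]) (use 1 in auto)
  next
    case 2
    \<comment> \<open>Caratheodory's criterion at 0: the slope function is the next lower power,
      which is continuous with value 0 there.\<close>
    have "\<exists>g. (\<forall>z. (max 0 z) ^ Suc (Suc k) - (max 0 0) ^ Suc (Suc k) = g z * (z - 0)) \<and>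
        isCont g 0 \<and> g 0 = (0::real)"
      by (intro exI[of _ "\<lambda>z. (max 0 z) ^ Suc k"] conjI continuous_intros) (auto simp: max_def)
    then have "((\<lambda>x::real. (max 0 x) ^ Suc (Suc k)) has_real_derivative 0) (at 0)"
      by (subst CARAT_DERIV)
    then show ?thesis
      using 2 by simp
  next
    case 3
    have "((\<lambda>x. x ^ Suc (Suc k)) has_real_derivative real (Suc (Suc k)) * (max 0 x) ^ Suc k) (at x)"
      using DERIV_pow[of "Suc (Suc k)" x] 3 by simp
    then show ?thesis
      by (rule has_field_derivative_transform_within_open[where S = "{0<..}"]) (use 3 in auto)
  qed
qed

text \<open>
  With \<open>q = max 0 ((s - a) (b - s)) ^ 3\<close>, which is \<open>C\<^sup>2\<close>, the functions \<open>c q / (1 + c q)\<close> increase to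
  the indicator of \<open>{a<..<b}\<close> as \<open>c\<close> tends to infinity.
\<close>

definition bump :: "real \<Rightarrow> real \<Rightarrow> real \<Rightarrow> real \<Rightarrow> real"
  where "bump a b c s = c * (max 0 ((s - a) * (b - s))) ^ 3 / (1 + c * (max 0 ((s - a) * (b - s))) ^ 3)"

lemma bump_eq_zero: "a \<le> b \<Longrightarrow> s \<notin> {a<..<b} \<Longrightarrow> bump a b c s = 0"
proof -
  assume "a \<le> b" "s \<notin> {a<..<b}"
  then have "(s - a) * (b - s) \<le> 0"
    by (auto simp: mult_le_0_iff)
  then show ?thesis
    by (simp add: bump_def max_absorb1)
qed

lemma bump_nonneg: "0 \<le> c \<Longrightarrow> 0 \<le> bump a b c s"
  by (simp add: bump_def)

lemma bump_le_one: "0 \<le> c \<Longrightarrow> bump a b c s \<le> 1"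
  by (auto simp: bump_def intro!: divide_le_eq_1_pos[THEN iffD2] add_pos_nonneg)

lemma bump_pos: "0 < c \<Longrightarrow> s \<in> {a<..<b} \<Longrightarrow> 0 < bump a b c s"
  by (auto simp: bump_def max_def mult_le_0_iff not_le intro!: divide_pos_pos add_pos_pos)

lemma bump_tendsto:
  assumes "a \<le> b"
  shows "(\<lambda>n. bump a b (real n) s) \<longlonglongrightarrow> indicator {a<..<b} s"
proof (cases "s \<in> {a<..<b}")
  case True
  define q where "q = (max 0 ((s - a) * (b - s))) ^ 3"
  have "q > 0"
    using True by (auto simp: q_def max_def mult_le_0_iff not_le)
  then have "(\<lambda>n. real n * q / (1 + real n * q)) \<longlonglongrightarrow> 1"
    by real_asymp
  then show ?thesis
    using True by (simp add: bump_def q_def)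
next
  case False
  then show ?thesis
    using bump_eq_zero[OF assms False] by simp
qed

text \<open>The cube of the positive part is twice continuously differentiable, and the denominator
  \<open>D\<close> is positive because \<open>0 \<le> c\<close>. The two derivatives are written out
  so that continuity of the second can be read off.\<close>

lemma bump_C2:
  assumes "a \<le> b" "0 \<le> c"
  shows "C2_supported_in (\<bar>a\<bar> + \<bar>b\<bar>) (bump a b c)"
proof -
  define p where "p = (\<lambda>s. (s - a) * (b - s))"
  define p' where "p' = (\<lambda>s. a + b - 2 * s)"
  define q where "q = (\<lambda>s. (max 0 (p s)) ^ 3)"
  define q' where "q' = (\<lambda>s. 3 * (max 0 (p s))\<^sup>2 * p' s)"
  define q'' where "q'' = (\<lambda>s. 6 * max 0 (p s) * (p' s)\<^sup>2 - 6 * (max 0 (p s))\<^sup>2)"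
  define D where "D = (\<lambda>s. 1 + c * q s)"
  have Dpos: "D s > 0" for s
    using assms(2) by (auto simp: D_def q_def intro!: add_pos_nonneg)
  have D0: "D s \<noteq> 0" for s
    using Dpos[of s] by simp
  have dp: "(p has_real_derivative p' s) (at s)" for s
    unfolding p_def p'_def by (auto intro!: derivative_eq_intros simp: algebra_simps)
  have dp': "(p' has_real_derivative -2) (at s)" for s
    unfolding p'_def by (auto intro!: derivative_eq_intros)
  have dq: "(q has_real_derivative q' s) (at s)" for s
    using DERIV_chain2[OF max_zero_power_has_derivative[of 1] dp, of s]
    by (simp add: q_def q'_def numeral_3_eq_3 numeral_2_eq_2)
  have dm: "((\<lambda>s. (max 0 (p s))\<^sup>2) has_real_derivative 2 * max 0 (p s) * p' s) (at s)" for s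
    using DERIV_chain2[OF max_zero_power_has_derivative[of 0] dp, of s]
    by (simp add: numeral_2_eq_2)
  have dq': "(q' has_real_derivative q'' s) (at s)" for s
    unfolding q'_def q''_def
    by (rule derivative_eq_intros dm dp' refl)+ (simp add: algebra_simps power2_eq_square)
  have dD: "(D has_real_derivative c * q' s) (at s)" for s
    unfolding D_def by (auto intro!: derivative_eq_intros dq)
  have bump: "bump a b c = (\<lambda>s. c * q s / D s)"
    by (simp add: bump_def fun_eq_iff q_def D_def p_def)
  define f' where "f' = (\<lambda>s. c * q' s / (D s)\<^sup>2)"
  define f'' where "f'' = (\<lambda>s. (c * q'' s * (D s)\<^sup>2 - c * q' s * (2 * D s * (c * q' s))) / (D s) ^ 4)"
  have "(bump a b c has_real_derivative f' s) (at s)" for s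
  proof -
    have "(bump a b c has_real_derivative
        (c * q' s * D s - c * q s * (c * q' s)) / (D s * D s)) (at s)"
      unfolding bump by (intro DERIV_divide DERIV_cmult dq dD D0)
    \<comment> \<open>The numerator of the quotient rule collapses because
      \<open>D = 1 + c * q\<close>.\<close>
    moreover have "c * q' s * D s - c * q s * (c * q' s) = c * q' s"
      by (simp add: D_def algebra_simps)
    ultimately show ?thesis
      by (simp add: f'_def power2_eq_square)
  qed
  moreover have "(f' has_real_derivative f'' s) (at s)" for s
  proof -
    have "((\<lambda>s. (D s)\<^sup>2) has_real_derivative 2 * D s * (c * q' s)) (at s)"
      using DERIV_power[OF dD, of 2 s] by (simp add: mult_ac)
    then have "(f' has_real_derivative
        (c * q'' s * (D s)\<^sup>2 - c * q' s * (2 * D s * (c * q' s))) / ((D s)\<^sup>2 * (D s)\<^sup>2)) (at s)"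
      unfolding f'_def using D0 by (intro DERIV_divide DERIV_cmult dq') simp_all
    moreover have "(D s)\<^sup>2 * (D s)\<^sup>2 = (D s) ^ 4"
      by (simp flip: power_add)
    ultimately show ?thesis
      by (simp add: f''_def)
  qed
  moreover have "continuous_on UNIV f''"
    unfolding f''_def D_def q''_def q'_def q_def p'_def p_def
    using D0 unfolding D_def q_def p_def by (intro continuous_intros) auto
  moreover have "bump a b c s = 0" if "\<bar>a\<bar> + \<bar>b\<bar> < \<bar>s\<bar>" for s
    using that by (intro bump_eq_zero assms) auto
  ultimately show ?thesis
    unfolding C2_supported_in_def by blast
qed

text \<open>The bumps with parameter \<open>n\<close> converge to the indicator of the open
  interval, and the products with \<open>g\<close> are dominated by the absolute value of
  \<open>g\<close> on the closed interval.\<close>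

lemma integral_interval_eq_zero_if_test:
  fixes g :: "real \<Rightarrow> real"
  assumes int: "\<And>R. set_integrable lborel {-R..R} g"
    and test: "\<And>R \<phi>. C2_supported_in R \<phi> \<Longrightarrow> (\<integral>s. \<phi> s * g s \<partial>lborel) = 0"
  shows "(\<integral>s. indicator {a<..<b} s * g s \<partial>lborel) = 0"
proof (cases "a \<le> b")
  case True
  have int_ab: "integrable lborel (\<lambda>s. indicator {a..b} s * g s)"
  proof -
    have "set_integrable lborel {a..b} g"
      by (rule set_integrable_subset[OF int[of "\<bar>a\<bar> + \<bar>b\<bar>"]]) auto
    then show ?thesis
      by (simp add: set_integrable_def)
  qed
  have "(\<lambda>s. indicator {a<..<b} s * (indicator {a..b} s * g s)) \<in> borel_measurable lborel"
    by (intro borel_measurable_times[OF _ borel_measurable_integrable[OF int_ab]]) simp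
  also have "(\<lambda>s. indicator {a<..<b} s * (indicator {a..b} s * g s)) = (\<lambda>s. indicator {a<..<b} s * g s)"
    by (auto simp: indicator_def fun_eq_iff)
  finally have meas: "(\<lambda>s. indicator {a<..<b} s * g s) \<in> borel_measurable lborel" .
  have bump_meas: "bump a b (real n) \<in> borel_measurable borel" for n
    by (intro borel_measurable_continuous_onI C2_supported_in_continuous[OF bump_C2] True) simp
  \<comment> \<open>Inserting the indicator changes nothing, so measurability of the product follows
    from that of \<open>g\<close> restricted to the interval.\<close>
  have eq: "bump a b (real n) s * (indicator {a<..<b} s * g s) = bump a b (real n) s * g s" for n s
    using bump_eq_zero[OF True, of s "real n"] by (auto simp: indicator_def)
  have "(\<lambda>n. \<integral>s. bump a b (real n) s * g s \<partial>lborel)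
      \<longlonglongrightarrow> (\<integral>s. indicator {a<..<b} s * g s \<partial>lborel)"
  proof (rule integral_dominated_convergence)
    show "integrable lborel (\<lambda>s. \<bar>indicator {a..b} s * g s\<bar>)"
      using int_ab by (rule integrable_abs)
    show "AE s in lborel. (\<lambda>n. bump a b (real n) s * g s) \<longlonglongrightarrow> indicator {a<..<b} s * g s"
      by (intro AE_I2 tendsto_mult bump_tendsto True tendsto_const)
    show "(\<lambda>s. bump a b (real n) s * g s) \<in> borel_measurable lborel" for n
      using borel_measurable_times[OF _ meas, of "bump a b (real n)"] bump_meas by (simp add: eq)
    show "AE s in lborel. norm (bump a b (real n) s * g s) \<le> \<bar>indicator {a..b} s * g s\<bar>" for n
    proof (rule AE_I2)
      fix s
      have "\<bar>bump a b (real n) s\<bar> \<le> indicator {a..b} s"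
        using bump_eq_zero[OF True, of s "real n"] bump_le_one[of "real n" a b s]
          bump_nonneg[of "real n" a b s] by (auto simp: indicator_def)
      then show "norm (bump a b (real n) s * g s) \<le> \<bar>indicator {a..b} s * g s\<bar>"
        by (simp add: abs_mult mult_right_mono)
    qed
  qed (rule meas)
  moreover have "(\<integral>s. bump a b (real n) s * g s \<partial>lborel) = 0" for n
    by (rule test[OF bump_C2[OF True]]) simp
  ultimately show ?thesis
    by (simp add: LIMSEQ_const_iff)
qed simp

text \<open>On each \<open>{- real n..real n}\<close> the integrals over half-open intervals vanish.
  These intervals are stable under intersection and generate the Borel sets, so the integral over
  every Borel set vanishes and hence so does the density almost everywhere.\<close>

lemma AE_zero_if_test:
  fixes g :: "real \<Rightarrow> real"
  assumes int: "\<And>R. set_integrable lborel {-R..R} g"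
    and test: "\<And>R \<phi>. C2_supported_in R \<phi> \<Longrightarrow> (\<integral>s. \<phi> s * g s \<partial>lborel) = 0"
  shows "AE s in lborel. g s = 0"
proof -
  have "AE s in lborel. indicator {- real n..real n} s *\<^sub>R g s = 0" for n
  proof (rule sigma_finite_measure.density_zero[OF sigma_finite_lborel])
    define f where "f = (\<lambda>s. indicator {- real n..real n} s *\<^sub>R g s)"
    have f: "integrable lborel f"
      using int[of "real n"] by (simp add: set_integrable_def f_def)
    then show "integrable lborel (\<lambda>s. indicator {- real n..real n} s *\<^sub>R g s)"
      by (simp add: f_def)
    have Ioc: "(LINT s:{a<..b}|lborel. f s) = 0" for a b
    proof -
      \<comment> \<open>Clipping to the support of \<open>f\<close> leaves an open interval that
        misses at most the two end points, a null set.\<close>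
      define a' where "a' = max a (- real n)"
      define b' where "b' = min b (real n)"
      have "(LINT s:{a<..b}|lborel. f s) = (\<integral>s. indicator {a'<..<b'} s * g s \<partial>lborel)"
        unfolding set_lebesgue_integral_def
      proof (rule integral_cong_AE)
        show "(\<lambda>s. indicator {a<..b} s *\<^sub>R f s) \<in> borel_measurable lborel"
          using f by (intro borel_measurable_scaleR) auto
        have "(\<lambda>s. indicator {a'<..<b'} s * g s) = (\<lambda>s. indicator {a'<..<b'} s *\<^sub>R f s)"
          by (auto simp: fun_eq_iff indicator_def f_def a'_def b'_def)
        moreover have "(\<lambda>s. indicator {a'<..<b'} s *\<^sub>R f s) \<in> borel_measurable lborel"
          using f by (intro borel_measurable_scaleR) auto
        ultimately show "(\<lambda>s. indicator {a'<..<b'} s * g s) \<in> borel_measurable lborel"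
          by simp
        show "AE s in lborel. indicator {a<..b} s *\<^sub>R f s = indicator {a'<..<b'} s * g s"
          using AE_lborel_singleton[of a'] AE_lborel_singleton[of b'] 
          by eventually_elim (auto simp: indicator_def f_def a'_def b'_def)
      qed
      also have "\<dots> = 0"
        by (rule integral_interval_eq_zero_if_test[OF int test])
      finally show ?thesis .
    qed
    have sets: "sets (lborel :: real measure) = sigma_sets UNIV (range (\<lambda>(a, b). {a <.. b::real}))"
      by (simp add: borel_sigma_sets_Ioc)
    have Int: "Int_stable (range (\<lambda>(a, b). {a <.. b::real}))"
      by (auto simp: Int_stable_def)
    have full: "(\<integral>s. f s \<partial>lborel) = 0"
    proof -
      \<comment> \<open>A half-open interval omits its left end point; starting at
        \<open>- real n - 1\<close> makes it contain the whole support. The total integral is what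
        the complement step below needs.\<close>
      have "(LINT s:{- real n - 1<..real n}|lborel. f s) = (\<integral>s. f s \<partial>lborel)"
        unfolding set_lebesgue_integral_def
        by (rule Bochner_Integration.integral_cong) (auto simp: f_def indicator_def)
      then show ?thesis
        using Ioc by simp
    qed
    have f_set: "set_integrable lborel A f" if "A \<in> sets lborel" for A
      using integrable_mult_indicator[OF that f] by (simp add: set_integrable_def)
    fix A :: "real set"
    assume "A \<in> sets lborel"
    then have A: "A \<in> sigma_sets UNIV (range (\<lambda>(a, b). {a <.. b::real}))"
      using sets by simp
    have "range (\<lambda>(a, b). {a <.. b::real}) \<subseteq> Pow UNIV"
      by simp
    from this A have "(LINT s:A|lborel. f s) = 0"
    proof (induction rule: sigma_sets_induct_disjoint[OF Int,
          consumes 2, case_names basic empty compl union])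
      case (basic A)
      then show ?case
        using Ioc by auto
    next
      case empty
      then show ?case
        by (simp add: set_lebesgue_integral_def)
    next
      case (compl A)
      then have A: "A \<in> sets lborel"
        using sets by simp
      have "(LINT s:UNIV - A|lborel. f s) = (\<integral>s. f s - indicator A s *\<^sub>R f s \<partial>lborel)"
        unfolding set_lebesgue_integral_def
        by (rule Bochner_Integration.integral_cong) (auto simp: indicator_def)
      also have "\<dots> = (\<integral>s. f s \<partial>lborel) - (LINT s:A|lborel. f s)"
        using f_set[OF A] f by (simp add: set_lebesgue_integral_def set_integrable_def)
      finally show ?case
        using full compl by simp
    next
      case (union A)
      then have A: "A i \<in> sets lborel" for i
        using sets by auto
      have "(LINT s:(\<Union>i. A i)|lborel. f s) = (\<Sum>i. (LINT s:A i|lborel. f s))"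
        using A union(1) by (intro lebesgue_integral_countable_add f_set) (auto simp: disjoint_family_on_def)
      then show ?case
        using union by simp
    qed
    then show "(LINT s:A|lborel. indicator {- real n..real n} s *\<^sub>R g s) = 0"
      by (simp add: f_def)
  qed
  then have "AE s in lborel. \<forall>n. indicator {- real n..real n} s *\<^sub>R g s = 0"
    unfolding AE_all_countable by (rule allI)
  then show ?thesis
  proof eventually_elim
    case (elim s)
    obtain n :: nat where "\<bar>s\<bar> \<le> real n"
      using real_arch_simple by blast
    then show ?case
      using elim[rule_format, of n] by (auto simp: indicator_def abs_le_iff split: if_splits)
  qed
qed

section \<open>The Hilbert space structure of \<open>\<K>\<close>\<close>

text \<open>
  Gluing \<open>y\<close> and \<open>u\<close> identifies \<open>\<K>\<close> with \<open>L\<^sup>2(\<real>, \<E>) \<oplus> \<H>\<close>; the value \<open>0\<close> at the origin makes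
  most identities hold pointwise rather than almost everywhere.
\<close>

definition glue :: "('h, 'e::real_vector) kvec \<Rightarrow> real \<Rightarrow> 'e"
  where "glue k s = indicator {..<0} s *\<^sub>R fst k s + indicator {0<..} s *\<^sub>R snd (snd k) s"

definition K_inner :: "('h::chilbert_space, 'e::{chilbert_space,second_countable_topology}) kvec
    \<Rightarrow> ('h, 'e) kvec \<Rightarrow> real"
  where "K_inner k k' = (\<integral>s. inner (glue k s) (glue k' s) \<partial>lborel) + inner (fst (snd k)) (fst (snd k'))"

lemma glue_add: "glue (k + k') s = glue k s + glue k' s"
  by (simp add: glue_def scaleR_add_right algebra_simps)

lemma glue_diff: "glue (k - k') s = glue k s - glue k' s"
  by (simp add: glue_def scaleR_diff_right algebra_simps)

lemma glue_zero: "glue 0 s = 0"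
  by (simp add: glue_def)

lemma glue_scale: "glue (K_scale c k) s = c *\<^sub>C glue k s"
  by (cases k) (simp add: glue_def scaleC_add_right scaleR_scaleC scaleC_scaleR mult.commute)

lemma glue_embed: "glue (K_embed h) s = 0"
  by (simp add: glue_def K_embed_def)

lemma glue_neg: "s < 0 \<Longrightarrow> glue k s = fst k s"
  and glue_pos: "0 < s \<Longrightarrow> glue k s = snd (snd k) s"
  and glue_at_zero: "glue k 0 = 0"
  by (simp_all add: glue_def)

text \<open>Restricting \<open>glue k\<close> to the two open half lines recovers the components, so
  membership becomes a condition on a single function on the line.\<close>

lemma K_space_iff_glue:
  fixes k :: "('h::chilbert_space, 'e::{chilbert_space,second_countable_topology}) kvec"
  shows "k \<in> K_space \<longleftrightarrow>
    glue k \<in> borel_measurable borel \<and> integrable lborel (\<lambda>s. (norm (glue k s))\<^sup>2)"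
proof (cases k)
  case (fields y h u)
  have g: "glue k = (\<lambda>s. indicator {..<0} s *\<^sub>R y s + indicator {0<..} s *\<^sub>R u s)"
    by (simp add: fun_eq_iff glue_def fields)
  have gn: "(\<lambda>s. (norm (glue k s))\<^sup>2) =
      (\<lambda>s. indicator {..<0} s *\<^sub>R (norm (y s))\<^sup>2 + indicator {0<..} s *\<^sub>R (norm (u s))\<^sup>2)"
    by (auto simp: fun_eq_iff g indicator_def)
  have y: "indicator {..<0} s *\<^sub>R y s = indicator {..<0} s *\<^sub>R glue k s"
    and u: "indicator {0<..} s *\<^sub>R u s = indicator {0<..} s *\<^sub>R glue k s"
    and yn: "indicator {..<0} s *\<^sub>R (norm (y s))\<^sup>2 = indicator {..<0} s *\<^sub>R (norm (glue k s))\<^sup>2"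
    and un: "indicator {0<..} s *\<^sub>R (norm (u s))\<^sup>2 = indicator {0<..} s *\<^sub>R (norm (glue k s))\<^sup>2" for s
    by (auto simp: g indicator_def)
  show ?thesis
  proof
    assume "k \<in> K_space"
    then have "square_integrable {..<0} y" "square_integrable {0<..} u"
      by (simp_all add: K_space_def fields)
    then show "glue k \<in> borel_measurable borel \<and> integrable lborel (\<lambda>s. (norm (glue k s))\<^sup>2)"
      unfolding gn by (simp add: square_integrable_def g set_borel_measurable_def set_integrable_def
          borel_measurable_add)
  next
    assume *: "glue k \<in> borel_measurable borel \<and> integrable lborel (\<lambda>s. (norm (glue k s))\<^sup>2)"
    then have "(\<lambda>s. indicator A s *\<^sub>R glue k s) \<in> borel_measurable borel"
      "integrable lborel (\<lambda>s. indicator A s *\<^sub>R (norm (glue k s))\<^sup>2)" if "A \<in> sets borel" for A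
      using that by (auto intro!: borel_measurable_scaleR integrable_mult_indicator
          simp del: real_scaleR_def)
    then show "k \<in> K_space"
      unfolding K_space_def square_integrable_def set_borel_measurable_def set_integrable_def
      by (simp only: fields mem_Collect_eq prod.case y u yn un) simp
  qed
qed

lemma K_space_measurable: "k \<in> K_space \<Longrightarrow> glue k \<in> borel_measurable borel"
  and K_space_integrable: "k \<in> K_space \<Longrightarrow> integrable lborel (\<lambda>s. (norm (glue k s))\<^sup>2)"
  by (simp_all add: K_space_iff_glue)

lemma K_norm_glue:
  assumes "k \<in> K_space"
  shows "(K_norm k)\<^sup>2 = (\<integral>s. (norm (glue k s))\<^sup>2 \<partial>lborel) + (norm (fst (snd k)))\<^sup>2"
proof (cases k)
  case (fields y h u)
  have int: "integrable lborel (\<lambda>s. indicator {..<0} s *\<^sub>R (norm (y s))\<^sup>2)"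
    "integrable lborel (\<lambda>s. indicator {0<..} s *\<^sub>R (norm (u s))\<^sup>2)"
    using assms by (simp_all add: K_space_def fields square_integrable_def set_integrable_def)
  have "(\<lambda>s. (norm (glue k s))\<^sup>2) =
      (\<lambda>s. indicator {..<0} s *\<^sub>R (norm (y s))\<^sup>2 + indicator {0<..} s *\<^sub>R (norm (u s))\<^sup>2)"
    by (auto simp: fun_eq_iff glue_def fields indicator_def)
  then have eq: "(\<integral>s. (norm (glue k s))\<^sup>2 \<partial>lborel)
      = (LINT s:{..<0}|lborel. (norm (y s))\<^sup>2) + (LINT s:{0<..}|lborel. (norm (u s))\<^sup>2)"
    using Bochner_Integration.integral_add[OF int] by (simp add: set_lebesgue_integral_def)
  have nonneg: "0 \<le> (LINT s:{..<0}|lborel. (norm (y s))\<^sup>2)"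
    "0 \<le> (LINT s:{0<..}|lborel. (norm (u s))\<^sup>2)"
    unfolding set_lebesgue_integral_def by (rule integral_nonneg_AE, simp)+
  show ?thesis
    unfolding eq by (simp add: fields add_nonneg_nonneg nonneg)
qed

lemma integrable_K_inner:
  assumes "k \<in> K_space" "k' \<in> K_space"
  shows "integrable lborel (\<lambda>s. inner (glue k s) (glue k' s))"
proof (rule Bochner_Integration.integrable_bound)
  show "integrable lborel (\<lambda>s. (norm (glue k s))\<^sup>2 + (norm (glue k' s))\<^sup>2)"
    by (intro Bochner_Integration.integrable_add K_space_integrable assms)
  show "(\<lambda>s. inner (glue k s) (glue k' s)) \<in> borel_measurable lborel"
    using K_space_measurable[OF assms(1)] K_space_measurable[OF assms(2)]
    by (intro borel_measurable_inner) simp_all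
  show "AE s in lborel. norm (inner (glue k s) (glue k' s))
      \<le> norm ((norm (glue k s))\<^sup>2 + (norm (glue k' s))\<^sup>2)"
    by (simp add: add_nonneg_nonneg abs_inner_le_sum_squares)
qed

lemma K_space_add:
  assumes "k \<in> K_space" "k' \<in> K_space"
  shows "k + k' \<in> K_space"
proof -
  have g: "glue (k + k') = (\<lambda>s. glue k s + glue k' s)"
    by (simp add: glue_add fun_eq_iff)
  show ?thesis
    unfolding K_space_iff_glue g norm_add_squared
    by (intro conjI borel_measurable_add K_space_measurable Bochner_Integration.integrable_add
        integrable_mult_right integrable_K_inner K_space_integrable assms)
qed

lemma K_space_scale:
  assumes "k \<in> K_space"
  shows "K_scale c k \<in> K_space"
proof -
  have g: "glue (K_scale c k) = (\<lambda>s. c *\<^sub>C glue k s)"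
    by (simp add: glue_scale fun_eq_iff)
  have "(\<lambda>s. c *\<^sub>C glue k s) \<in> borel_measurable borel"
    by (intro measurable_compose[OF K_space_measurable[OF assms]] borel_measurable_continuous_onI
        linear_continuous_on bounded_linear_scaleC_right)
  then show ?thesis
    unfolding K_space_iff_glue g using K_space_integrable[OF assms]
    by (simp add: norm_scaleC power_mult_distrib)
qed

lemma K_scale_one: "K_scale 1 k = (k :: ('h::chilbert_space, 'e::chilbert_space) kvec)"
  by (cases k) (simp add: scaleC_one)

lemma K_space_diff:
  assumes "k \<in> K_space" "k' \<in> K_space"
  shows "k - k' \<in> K_space"
proof -
  have "K_scale (- 1) k' = - k'"
    by (cases k') (simp add: uminus_prod_def fun_eq_iff scaleC_minus_one)
  then show ?thesis
    using K_space_add[OF assms(1) K_space_scale[OF assms(2)], of "- 1"] by simp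
qed

lemma K_embed_in_K_space:
  "(K_embed h :: ('h::chilbert_space, 'e::{chilbert_space,second_countable_topology}) kvec) \<in> K_space"
proof -
  have "glue (K_embed h :: ('h, 'e) kvec) = (\<lambda>s. 0)"
    by (simp add: glue_embed fun_eq_iff)
  then show ?thesis
    unfolding K_space_iff_glue by simp
qed

section \<open>Polarization, unitary maps and orthogonality\<close>

lemma K_norm_add:
  assumes "k \<in> K_space" "k' \<in> K_space"
  shows "(K_norm (k + k'))\<^sup>2 = (K_norm k)\<^sup>2 + (K_norm k')\<^sup>2 + 2 * K_inner k k'"
  using K_space_integrable[OF assms(1)] K_space_integrable[OF assms(2)] integrable_K_inner[OF assms]
  by (simp add: K_norm_glue K_space_add assms glue_add norm_add_squared K_inner_def)

lemma K_norm_diff: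
  assumes "k \<in> K_space" "k' \<in> K_space"
  shows "(K_norm (k - k'))\<^sup>2 = (K_norm k)\<^sup>2 + (K_norm k')\<^sup>2 - 2 * K_inner k k'"
  using K_space_integrable[OF assms(1)] K_space_integrable[OF assms(2)] integrable_K_inner[OF assms]
  by (simp add: K_norm_glue K_space_diff assms glue_diff norm_diff_squared K_inner_def)

lemma K_eq_iff_glue:
  "K_eq k k' \<longleftrightarrow> (AE s in lborel. glue k s = glue k' s) \<and> fst (snd k) = fst (snd k')"
proof (cases k; cases k')
  fix y h u y' h' u'
  assume k: "k = (y, h, u)" "k' = (y', h', u')"
  have "glue k s = glue k' s \<longleftrightarrow> (s < 0 \<longrightarrow> y s = y' s) \<and> (0 < s \<longrightarrow> u s = u' s)" for s
    by (cases s "0::real" rule: linorder_cases) (simp_all add: k glue_neg glue_pos glue_at_zero)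
  then show ?thesis
    by (auto simp: k AE_conj_iff)
qed

lemma K_eq_trans:
  fixes k k' k'' :: "('h, 'e::real_vector) kvec"
  shows "K_eq k k' \<Longrightarrow> K_eq k' k'' \<Longrightarrow> K_eq k k''"
  unfolding K_eq_iff_glue by auto

lemma K_eq_sym:
  fixes k k' :: "('h, 'e::real_vector) kvec"
  shows "K_eq k k' \<Longrightarrow> K_eq k' k"
  unfolding K_eq_iff_glue by (auto simp: eq_commute)

lemma K_norm_cong:
  assumes "k \<in> K_space" "k' \<in> K_space" "K_eq k k'"
  shows "(K_norm k)\<^sup>2 = (K_norm k')\<^sup>2"
proof -
  have "(\<integral>s. (norm (glue k s))\<^sup>2 \<partial>lborel) = (\<integral>s. (norm (glue k' s))\<^sup>2 \<partial>lborel)"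
    using assms
    by (intro integral_cong_AE borel_measurable_integrable[OF K_space_integrable])
      (auto simp: K_eq_iff_glue)
  then show ?thesis
    using assms by (simp add: K_norm_glue K_eq_iff_glue)
qed

text \<open>Polarization of norm preservation. \<open>U\<close> is additive only up to
  \<open>K_eq\<close>, which is enough because the norm does not distinguish
  representatives.\<close>

lemma K_unitary_inner:
  assumes U: "K_unitary U" and k: "k \<in> K_space" "k' \<in> K_space"
  shows "K_inner (U k) (U k') = K_inner k k'"
proof -
  have in_K: "U j \<in> K_space" "K_norm (U j) = K_norm j" if "j \<in> K_space" for j
    using U that by (auto simp: K_unitary_def)
  have "K_eq (U (k + k')) (U k + U k')"
    using U k K_scale_one unfolding K_unitary_def by metis
  then have "(K_norm (U k + U k'))\<^sup>2 = (K_norm (k + k'))\<^sup>2"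
    using K_norm_cong[OF in_K(1)[OF K_space_add[OF k]] K_space_add[OF in_K(1)[OF k(1)] in_K(1)[OF k(2)]]]
      in_K(2)[OF K_space_add[OF k]] by simp
  then show ?thesis
    by (simp add: K_norm_add in_K k)
qed

text \<open>The real inner product suffices: for a complex subspace, real orthogonality implies
  complex orthogonality. The quantifier over \<open>M\<close> stands inside, so one null set serves
  all \<open>m\<close>.\<close>

definition K_perp :: "'e::real_inner set \<Rightarrow> ('h, 'e) kvec \<Rightarrow> bool"
  where "K_perp M w \<longleftrightarrow> (AE s in lborel. \<forall>m\<in>M. inner m (glue w s) = 0)"

lemma K_perp_add: "K_perp M w \<Longrightarrow> K_perp M w' \<Longrightarrow> K_perp M (w + w')"
  unfolding K_perp_def by (auto simp: glue_add inner_add_right)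

lemma K_perp_scale: "closed_csubspace M \<Longrightarrow> K_perp M w \<Longrightarrow> K_perp M (K_scale c w)"
  unfolding K_perp_def by (auto simp: glue_scale inner_scaleC_right closed_csubspace_scaleC)

lemma K_inner_perp:
  assumes "AE s in lborel. glue k s \<in> M" "fst (snd k) = 0" "K_perp M w"
  shows "K_inner k w = 0"
proof -
  have "(\<integral>s. inner (glue k s) (glue w s) \<partial>lborel) = 0"
    by (rule integral_eq_zero_AE) (use assms in \<open>auto simp: K_perp_def\<close>)
  then show ?thesis
    using assms(2) by (simp add: K_inner_def)
qed

text \<open>The same profile is used on both half lines so that the two pieces fit together smoothly
  at the origin.\<close>

definition test_vec :: "(real \<Rightarrow> real) \<Rightarrow> 'e \<Rightarrow> ('h::chilbert_space, 'e::chilbert_space) kvec"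
  where "test_vec \<phi> v = ((\<lambda>s. \<phi> s *\<^sub>R v), 0, (\<lambda>s. \<phi> s *\<^sub>R v))"

lemma glue_test_vec: "s \<noteq> 0 \<Longrightarrow> glue (test_vec \<phi> v) s = \<phi> s *\<^sub>R v"
  by (auto simp: glue_def test_vec_def indicator_def)

lemma test_vec_in_K_space:
  assumes "C2_supported_in R \<phi>"
  shows "(test_vec \<phi> v :: ('h::chilbert_space, 'e::{chilbert_space,second_countable_topology}) kvec) \<in> K_space"
  by (simp add: test_vec_def K_space_def square_integrable_test[OF assms])

text \<open>For a fixed \<open>v\<close>, the pairing with \<open>test_vec \<phi> v\<close> is the
  integral of \<open>\<phi>\<close> against the scalar function \<open>inner v (glue w s)\<close>,
  which must vanish almost everywhere. Separability reduces all \<open>v\<close> in \<open>M\<close>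
  to countably many, and continuity of the inner product recovers the rest.\<close>

lemma K_perp_if_test:
  fixes M :: "'e::{chilbert_space,second_countable_topology} set"
    and w :: "('h::chilbert_space, 'e) kvec"
  assumes w: "w \<in> K_space"
    and test: "\<And>R \<phi> v. C2_supported_in R \<phi> \<Longrightarrow> v \<in> M \<Longrightarrow> K_inner (test_vec \<phi> v) w = 0"
  shows "K_perp M w"
proof -
  have one: "AE s in lborel. inner v (glue w s) = 0" if v: "v \<in> M" for v
  proof (rule AE_zero_if_test)
    show "(\<integral>s. \<phi> s * inner v (glue w s) \<partial>lborel) = 0" if "C2_supported_in R \<phi>" for R \<phi>
    proof -
      have "inner (glue (test_vec \<phi> v :: ('h, 'e) kvec) s) (glue w s) = \<phi> s * inner v (glue w s)" for s
        by (cases "s = 0") (simp_all add: glue_test_vec glue_at_zero)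
      then show ?thesis
        using test[OF that v] by (simp add: K_inner_def test_vec_def[of \<phi> v])
    qed
    show "set_integrable lborel {-R..R} (\<lambda>s. inner v (glue w s))" for R
      unfolding set_integrable_def
    proof (rule Bochner_Integration.integrable_bound)
      show "integrable lborel (\<lambda>s. indicator {-R..R} s *\<^sub>R (norm v)\<^sup>2 + (norm (glue w s))\<^sup>2)"
        by (intro Bochner_Integration.integrable_add K_space_integrable w borel_integrable_compact
            compact_Icc continuous_on_const)
      show "(\<lambda>s. indicator {-R..R} s *\<^sub>R inner v (glue w s)) \<in> borel_measurable lborel"
        using K_space_measurable[OF w] by simp
      show "AE s in lborel. norm (indicator {-R..R} s *\<^sub>R inner v (glue w s))
          \<le> norm (indicator {-R..R} s *\<^sub>R (norm v)\<^sup>2 + (norm (glue w s))\<^sup>2)"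
        by (simp add: indicator_def add_nonneg_nonneg abs_inner_le_sum_squares)
    qed
  qed
  obtain D where D: "countable D" "D \<subseteq> M" "M \<subseteq> closure D"
    using separable[of M] by blast
  have "AE s in lborel. \<forall>v\<in>D. inner v (glue w s) = 0"
    using D one by (subst AE_ball_countable) auto
  then show ?thesis
    unfolding K_perp_def
  proof eventually_elim
    case (elim s)
    have "closed {m. inner m (glue w s) = 0}"
      by (intro closed_Collect_eq continuous_intros)
    then have "closure D \<subseteq> {m. inner m (glue w s) = 0}"
      using elim by (intro closure_minimal) auto
    then show ?case
      using D(3) by auto
  qed
qed

section \<open>Vessels with an invariant subspace of \<open>\<W>\<close>\<close>

text \<open>For each frequency the exponent maps \<open>M\<close> to itself, hence so does its
  exponential; integrating values in a closed subspace stays inside it.\<close>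

lemma dagger_in_closed_csubspace:
  fixes a b :: "'n::finite \<Rightarrow> 'e::{chilbert_space,second_countable_topology} \<Rightarrow> 'e"
  assumes M: "closed_csubspace M"
    and a: "\<And>j. bounded_linear (a j)" "\<And>j m. m \<in> M \<Longrightarrow> a j m \<in> M"
    and b: "\<And>j. bounded_linear (b j)" "\<And>j m. m \<in> M \<Longrightarrow> b j m \<in> M"
    and f: "AE s in lborel. fourier f s \<in> M"
  shows "dagger a b f t \<in> M"
proof -
  let ?T = "\<lambda>s v. \<Sum>j\<in>UNIV. (t $ j) *\<^sub>R (s *\<^sub>R a j v + b j v)"
  have lin: "bounded_linear (?T s)" for s
    by (intro bounded_linear_sum bounded_linear_const_scaleR bounded_linear_add a b)
  have inv: "?T s ` M \<subseteq> M" for s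
    by (auto intro!: subspace_sum closed_csubspace_subspace[OF M] closed_csubspace_scaleR[OF M]
        closed_csubspace_add[OF M] a b)
  have "AE s in lborel. expi (?T s) (fourier f s) \<in> M"
    using f by eventually_elim (rule expi_in_closed_csubspace[OF M lin inv])
  then show ?thesis
    unfolding dagger_def
    by (intro closed_csubspace_scaleR M integral_in_closed_subspace closed_csubspace_subspace
        closed_csubspace_closed)
qed

locale vessel_with_subspace =
  fixes V :: "('h::{chilbert_space,second_countable_topology},
               'e::{chilbert_space,second_countable_topology}, 'n::{finite,one}) vessel"
    and M :: "'e set"
  assumes vessel: "is_vessel V"
    and sigma_one: "\<And>v. sigma V 1 v = v"
    and M: "closed_csubspace M"
    and M_W: "M \<subseteq> kernel_W V"
    and alpha_M: "\<And>j m. m \<in> M \<Longrightarrow> alpha V j m \<in> M"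
    and beta_M: "\<And>j m. m \<in> M \<Longrightarrow> beta V j m \<in> M"
begin

lemma vessel_bounded_linear:
  "bounded_linear (opA V j)" "bounded_linear (Phi V)" "bounded_linear (sigma V j)"
  "bounded_linear (gam V j k)" "bounded_linear (gams V j k)"
  using vessel by (simp_all add: is_vessel_def bounded_selfadjoint_def bounded_clinear_def)

lemmas M_sum = subspace_sum[OF closed_csubspace_subspace[OF M]]

lemma cadjoint_Phi_M: "m \<in> M \<Longrightarrow> cadjoint (Phi V) m = 0"
  using subsetD[OF M_W, of m] by (simp add: kernel_W_def) (metis sigma_one)

text \<open>The value is read off from the vessel identity for
  \<open>opA V j - cadjoint (opA V j)\<close> at 0, using that the chosen adjoint of
  \<open>Phi V\<close> kills 0 as an element of \<open>M\<close>.\<close>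

lemma cadjoint_opA_zero: "cadjoint (opA V j) 0 = 0"
proof -
  have "opA V j 0 - cadjoint (opA V j) 0 = \<i> *\<^sub>C cadjoint (Phi V) (sigma V j (Phi V 0))"
    using vessel unfolding is_vessel_def by blast
  then show ?thesis
    using closed_csubspace_zero[OF M]
    by (simp add: linear_simps[OF vessel_bounded_linear(1)] linear_simps[OF vessel_bounded_linear(2)]
        linear_simps[OF vessel_bounded_linear(3)] cadjoint_Phi_M)
qed

text \<open>Both terms in the vessel formula for \<open>gams - gam\<close> contain
  \<open>cadjoint (Phi V)\<close> applied to an element of \<open>M\<close>, so \<open>betas\<close>
  and \<open>beta\<close> agree on \<open>M\<close>.\<close>

lemma betas_M:
  assumes "m \<in> M"
  shows "betas V j m \<in> M"
proof -
  have "betas V j m - beta V j m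
      = \<i> *\<^sub>C (sigma V 1 (Phi V (cadjoint (Phi V) (sigma V j m)))
            - sigma V j (Phi V (cadjoint (Phi V) (sigma V 1 m))))"
    using vessel unfolding is_vessel_def by blast
  also have "\<dots> = 0"
    using assms alpha_M by (simp add: cadjoint_Phi_M sigma_one linear_simps[OF vessel_bounded_linear(2)]
        linear_simps[OF vessel_bounded_linear(3)])
  finally show ?thesis
    using beta_M[OF assms] by simp
qed

section \<open>The construction applied to test vectors with values in \<open>M\<close>\<close>

lemma x_line_test_vec:
  assumes "v \<in> M"
  shows "x_line V (test_vec \<phi> v) t = 0"
proof -
  have "cadjoint (Phi V) (\<phi> s *\<^sub>R v) = 0" for s
    by (intro cadjoint_Phi_M closed_csubspace_scaleR M assms)
  moreover have "expi (\<lambda>x. r *\<^sub>R opA V 1 x) 0 = 0" "expi (\<lambda>x. r *\<^sub>R cadjoint (opA V 1) x) 0 = 0" for r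
    by (rule expi_zero, simp add: cadjoint_opA_zero linear_simps[OF vessel_bounded_linear(1)])+
  \<comment> \<open>The same facts in the shape that simplification gives to the exponentials with
    scalar \<open>- s\<close>.\<close>
  moreover have "expi (\<lambda>x. - (r *\<^sub>R opA V 1 x)) 0 = 0" "expi (\<lambda>x. - (r *\<^sub>R cadjoint (opA V 1) x)) 0 = 0" for r
    by (rule expi_zero, simp add: cadjoint_opA_zero linear_simps[OF vessel_bounded_linear(1)])+
  ultimately show ?thesis
    by (simp add: test_vec_def set_lebesgue_integral_def)
qed

lemma tilde_test_vec:
  assumes "v \<in> M"
  shows "u_tilde V (test_vec \<phi> v) = (\<lambda>t. \<phi> t *\<^sub>R v)" "y_tilde V (test_vec \<phi> v) = (\<lambda>t. \<phi> t *\<^sub>R v)"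
  using x_line_test_vec[OF assms, of \<phi>]
  by (simp_all add: test_vec_def fun_eq_iff linear_simps[OF vessel_bounded_linear(2)]
      del: x_line.simps)

lemma test_vec_K_smooth:
  assumes "C2_supported_in R \<phi>" "v \<in> M"
  shows "test_vec \<phi> v \<in> K_smooth V"
  by (simp add: K_smooth_def tilde_test_vec assms(2) twice_C_L2_test[OF assms(1)]
      test_vec_in_K_space[OF assms(1)])

lemma dagger_test_vec:
  assumes "C2_supported_in R \<phi>" "v \<in> M"
  shows "u_dagger V (test_vec \<phi> v) t \<in> M" "y_dagger V (test_vec \<phi> v) t \<in> M"
  unfolding u_dagger_def y_dagger_def tilde_test_vec[OF assms(2)]
  by (intro dagger_in_closed_csubspace M vessel_bounded_linear alpha_M beta_M betas_M
      fourier_test_in_closed_csubspace[OF assms(1) M assms(2)]; assumption)+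

lemma x_traj_test_vec:
  assumes "C2_supported_in R \<phi>" "v \<in> M"
  shows "x_traj V (test_vec \<phi> v) t = 0"
proof -
  have "cadjoint (Phi V) (\<Sum>j\<in>UNIV. (t $ j) *\<^sub>R sigma V j (u_dagger V (test_vec \<phi> v) (r *\<^sub>R t))) = 0" for r
    by (intro cadjoint_Phi_M M_sum closed_csubspace_scaleR M alpha_M dagger_test_vec[OF assms])
  moreover have "expi (\<lambda>x. \<Sum>j\<in>UNIV. (s $ j) *\<^sub>R opA V j x) 0 = 0"
    "expi (\<lambda>x. - (\<Sum>j\<in>UNIV. (s $ j) *\<^sub>R opA V j x)) 0 = 0" for s
    by (rule expi_zero, simp add: linear_simps[OF vessel_bounded_linear(1)])+
  ultimately show ?thesis
    unfolding x_traj_def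
    by (simp add: set_lebesgue_integral_def test_vec_def[of \<phi> v] del: vector_scaleR_component)
qed

lemma rho_smooth_test_vec:
  assumes "C2_supported_in R \<phi>" "v \<in> M"
  shows "glue (rho_smooth V t (test_vec \<phi> v)) s \<in> M"
    "fst (snd (rho_smooth V t (test_vec \<phi> v))) = 0"
  by (auto simp: rho_smooth_def glue_def x_traj_test_vec[OF assms] intro!: closed_csubspace_add[OF M]
      closed_csubspace_scaleR[OF M] dagger_test_vec[OF assms])

text \<open>Since \<open>\<sigma>\<close> at index 1 is the identity, moving by \<open>r\<close>
  along the first axis adds \<open>r\<close> times the squared norm to the quadratic form, which
  eventually outweighs the bounded operator belonging to \<open>t\<close>.\<close>

lemma Pos_axis_shift:
  obtains c where "\<And>r. c \<le> r \<Longrightarrow> t + axis 1 r \<in> Pos V"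
proof -
  let ?T = "\<lambda>v. \<Sum>j\<in>UNIV. (t $ j) *\<^sub>R sigma V j v"
  have "bounded_linear ?T"
    by (intro bounded_linear_sum bounded_linear_const_scaleR vessel_bounded_linear)
  then obtain B where B: "0 \<le> B" "\<And>v. norm (?T v) \<le> norm v * B"
    using bounded_linear.nonneg_bounded by blast
  \<comment> \<open>Beyond the operator bound \<open>B\<close>, the margin 2 leaves a strict
    inequality for the choice \<open>\<epsilon> = 1\<close>.\<close>
  have "t + axis 1 r \<in> Pos V" if r: "B + 2 \<le> r" for r
    unfolding Pos_def
  proof (intro CollectI exI[of _ 1] conjI allI impI)
    fix v :: 'e
    assume "v \<noteq> 0"
    have "(\<Sum>j\<in>UNIV. ((t + axis 1 r) $ j) *\<^sub>R sigma V j v)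
        = (\<Sum>j\<in>UNIV. (t $ j) *\<^sub>R sigma V j v + (if j = 1 then r *\<^sub>R v else 0))"
      by (intro sum.cong refl) (simp add: axis_def scaleR_add_left sigma_one)
    also have "\<dots> = ?T v + r *\<^sub>R v"
      by (simp add: sum.distrib)
    finally have eq: "(\<Sum>j\<in>UNIV. ((t + axis 1 r) $ j) *\<^sub>R sigma V j v) = ?T v + r *\<^sub>R v" .
    have "\<bar>inner (?T v) v\<bar> \<le> norm (?T v) * norm v"
      by (rule Cauchy_Schwarz_ineq2)
    also have "\<dots> \<le> norm v * B * norm v"
      by (intro mult_right_mono B) simp
    finally have "- (B * (norm v)\<^sup>2) \<le> inner (?T v) v"
      by (simp add: power2_eq_square mult_ac abs_le_iff)
    moreover have "(B + 2) * (norm v)\<^sup>2 \<le> r * (norm v)\<^sup>2"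
      using r by (intro mult_right_mono) auto
    moreover have "0 < (norm v)\<^sup>2"
      using \<open>v \<noteq> 0\<close> by simp
    ultimately have "1 * (norm v)\<^sup>2 < inner (?T v) v + r * (norm v)\<^sup>2"
      unfolding distrib_right by linarith
    then have "1 * (norm v)\<^sup>2 < inner (?T v + r *\<^sub>R v) v"
      by (simp add: inner_add_left power2_norm_eq_inner)
    then show "1 * (norm v)\<^sup>2
        < Re (cinner (\<Sum>j\<in>UNIV. ((t + axis 1 r) $ j) *\<^sub>R sigma V j v) v)"
      by (simp only: eq inner_eq_Re_cinner)
  qed simp
  then show thesis
    by (rule that)
qed

section \<open>Orthogonality to \<open>M\<close> of the orbits of \<open>\<H>\<close> under the
  dilation\<close>

context
  fixes \<rho> :: "real ^ 'n::{finite,one} \<Rightarrow> ('h, 'e) kvec \<Rightarrow> ('h, 'e) kvec"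
  assumes dil: "dilation_of_vessel V \<rho>"
begin

lemma rho_unitary: "K_unitary (\<rho> t)"
  and rho_zero: "k \<in> K_space \<Longrightarrow> K_eq (\<rho> 0 k) k"
  and rho_add: "k \<in> K_space \<Longrightarrow> K_eq (\<rho> (s + t) k) (\<rho> s (\<rho> t k))"
  and rho_formula: "t \<in> Pos V \<union> uminus ` Pos V \<Longrightarrow> k \<in> K_smooth V \<Longrightarrow> K_eq (\<rho> t k) (rho_smooth V t k)"
  using dil by (simp_all add: dilation_of_vessel_def K_unitary_representation_def)

lemma rho_K_space: "k \<in> K_space \<Longrightarrow> \<rho> t k \<in> K_space"
  using rho_unitary[of t] by (simp add: K_unitary_def)

text \<open>The operator \<open>\<rho> s\<close> preserves inner products and sends test vectors to
  vectors with values in \<open>M\<close> and no component in \<open>\<H>\<close>; these are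
  orthogonal to \<open>\<rho> s w\<close>. The auxiliary \<open>w'\<close> is there because the
  group law holds only up to \<open>K_eq\<close>.\<close>

lemma K_perp_if_rho:
  assumes s: "s \<in> Pos V \<union> uminus ` Pos V" and w: "w \<in> K_space"
    and w': "K_eq (\<rho> s w) w'" "K_perp M w'"
  shows "K_perp M w"
proof (rule K_perp_if_test[OF w])
  fix R \<phi> v
  assume \<phi>: "C2_supported_in R \<phi>" and v: "v \<in> M"
  let ?k = "test_vec \<phi> v :: ('h, 'e) kvec"
  have "K_eq (\<rho> s ?k) (rho_smooth V s ?k)"
    using s test_vec_K_smooth[OF \<phi> v] by (rule rho_formula)
  then have "AE x in lborel. glue (\<rho> s ?k) x \<in> M" "fst (snd (\<rho> s ?k)) = 0"
    using rho_smooth_test_vec[OF \<phi> v, of s] by (auto simp: K_eq_iff_glue)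
  moreover have "K_perp M (\<rho> s w)"
    using w' by (auto simp: K_perp_def K_eq_iff_glue)
  ultimately have "K_inner (\<rho> s ?k) (\<rho> s w) = 0"
    by (rule K_inner_perp)
  then show "K_inner ?k w = 0"
    using K_unitary_inner[OF rho_unitary test_vec_in_K_space[OF \<phi>] w] by simp
qed

text \<open>Applying \<open>\<rho> (- t)\<close> returns to \<open>K_embed h\<close>, whose function
  components are 0.\<close>

lemma K_perp_rho_embed_Pos:
  assumes "- t \<in> Pos V"
  shows "K_perp M (\<rho> t (K_embed h))"
proof (rule K_perp_if_rho)
  show "K_eq (\<rho> (- t) (\<rho> t (K_embed h))) (K_embed h)"
    using K_eq_trans[OF K_eq_sym[OF rho_add[OF K_embed_in_K_space, of "- t" t h]]]
      rho_zero[OF K_embed_in_K_space, of h] by simp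
  show "K_perp M (K_embed h :: ('h, 'e) kvec)"
    by (simp add: K_perp_def glue_embed)
qed (use assms in \<open>auto intro: rho_K_space K_embed_in_K_space\<close>)

lemma K_perp_rho_embed: "K_perp M (\<rho> t (K_embed h))"
proof -
  obtain c where c: "\<And>r. c \<le> r \<Longrightarrow> t + axis 1 r \<in> Pos V"
    using Pos_axis_shift[of t] by blast
  obtain c' where c': "\<And>r. c' \<le> r \<Longrightarrow> 0 + axis 1 r \<in> Pos V"
    using Pos_axis_shift[of 0] by blast
  \<comment> \<open>With \<open>r\<close> this large, \<open>t\<close> is the difference of
    \<open>t + axis 1 r\<close> and \<open>axis 1 r\<close>, both in \<open>Pos V\<close>. Applying
    \<open>\<rho>\<close> at minus the first leaves \<open>\<rho> (- axis 1 r) (K_embed h)\<close>,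
    the case already settled.\<close>
  define r where "r = max c c'"
  have r: "t + axis 1 r \<in> Pos V" "axis 1 r \<in> Pos V"
    using c[of r] c'[of r] by (simp_all add: r_def)
  show ?thesis
  proof (rule K_perp_if_rho)
    show "- (t + axis 1 r) \<in> Pos V \<union> uminus ` Pos V"
      using r by blast
    show "K_perp M (\<rho> (- axis 1 r) (K_embed h))"
      using r by (intro K_perp_rho_embed_Pos) simp
    show "K_eq (\<rho> (- (t + axis 1 r)) (\<rho> t (K_embed h))) (\<rho> (- axis 1 r) (K_embed h))"
      using rho_add[OF K_embed_in_K_space, of "- (t + axis 1 r)" t h] by (simp add: K_eq_sym)
  qed (intro rho_K_space K_embed_in_K_space)
qed

lemma K_perp_rho_span:
  "(\<Sum>i<N::nat. K_scale (c i) (\<rho> (t i) (K_embed (h i)))) \<in> K_space \<and>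
    K_perp M (\<Sum>i<N. K_scale (c i) (\<rho> (t i) (K_embed (h i))))"
proof (induction N)
  case 0
  have "glue (0 :: ('h, 'e) kvec) = (\<lambda>s. 0)"
    by (simp add: glue_zero fun_eq_iff)
  then show ?case
    by (simp add: K_space_iff_glue K_perp_def)
next
  case (Suc N)
  then show ?case
    by (simp add: K_space_add K_space_scale rho_K_space K_embed_in_K_space K_perp_add K_perp_scale M
        K_perp_rho_embed)
qed

end

end

text \<open>The bump is positive on the interval from 1 to 2, which has positive measure and lies in
  the positive half line.\<close>

lemma K_norm_test_vec_pos:
  fixes v :: "'e::{chilbert_space,second_countable_topology}"
  assumes "v \<noteq> 0"
  shows "0 < (K_norm (test_vec (bump 1 2 1) v :: ('h::chilbert_space, 'e) kvec))\<^sup>2"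
proof -
  let ?k = "test_vec (bump 1 2 1) v :: ('h, 'e) kvec"
  have k: "?k \<in> K_space"
    by (rule test_vec_in_K_space[OF bump_C2]) simp_all
  have "(\<integral>s. (norm (glue ?k s))\<^sup>2 \<partial>lborel) \<noteq> 0"
  proof
    assume "(\<integral>s. (norm (glue ?k s))\<^sup>2 \<partial>lborel) = 0"
    then have "AE s in lborel. (norm (glue ?k s))\<^sup>2 = 0"
      using integral_nonneg_eq_0_iff_AE[OF K_space_integrable[OF k]] by simp
    then have "AE s in lborel. s \<notin> {1<..<2::real}"
    proof eventually_elim
      case (elim s)
      then show ?case
        using bump_pos[of 1 s 1 2] assms by (cases "s = 0") (auto simp: glue_test_vec)
    qed
    then have "emeasure lborel {1<..<2::real} = 0"
      by (subst (asm) AE_iff_measurable[of "{1<..<2}"]) auto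
    then show False
      by simp
  qed
  moreover have "0 \<le> (\<integral>s. (norm (glue ?k s))\<^sup>2 \<partial>lborel)"
    by (rule integral_nonneg_AE) simp
  ultimately have "0 < (\<integral>s. (norm (glue ?k s))\<^sup>2 \<partial>lborel)"
    by linarith
  then show ?thesis
    unfolding K_norm_glue[OF k] by (rule add_pos_nonneg) simp
qed

theorem proposition7p11:
  fixes V :: "('h::{chilbert_space,second_countable_topology},
               'e::{chilbert_space,second_countable_topology}, 'n::{finite,one}) vessel"
    and \<rho> :: "real ^ 'n::{finite,one} \<Rightarrow> ('h, 'e) kvec \<Rightarrow> ('h, 'e) kvec"
  assumes dissipative: "\<forall>j. dissipative (opA V j)"
    and realizes: "realizes_dissipative_embedding V"
    and dilation: "dilation_of_vessel V \<rho>"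
    and invariant_subspace: "\<exists>M. closed_csubspace M \<and> M \<noteq> {0} \<and> M \<subseteq> kernel_W V \<and>
           (\<forall>j. alpha V j ` M \<subseteq> M \<and> beta V j ` M \<subseteq> M)"
  shows "\<not> minimal_dilation \<rho>"
proof
  assume minimal: "minimal_dilation \<rho>"
  obtain M where subspace: "closed_csubspace M" "M \<noteq> {0}" "M \<subseteq> kernel_W V"
    and inv: "\<forall>j. alpha V j ` M \<subseteq> M \<and> beta V j ` M \<subseteq> M"
    using invariant_subspace by (elim exE conjE)
  interpret vessel_with_subspace V M
  proof
    show "is_vessel V" "sigma V 1 v = v" for v
      using realizes by (simp_all add: realizes_dissipative_embedding_def)
    show "alpha V j m \<in> M" "beta V j m \<in> M" if "m \<in> M" for j m
      using inv[THEN spec, of j] that by (simp_all add: image_subset_iff)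
  qed (fact subspace)+
  obtain v where v: "v \<in> M" "v \<noteq> 0"
    using subspace(2) closed_csubspace_zero[OF M] by blast
  let ?k = "test_vec (bump 1 2 1) v :: ('h, 'e) kvec"
  have k: "?k \<in> K_space"
    by (rule test_vec_in_K_space[OF bump_C2]) simp_all
  \<comment> \<open>The tolerance for the approximation is the norm of \<open>?k\<close>, written as
    the root of its square because the norm formulas are stated for squares.\<close>
  have "0 < sqrt ((K_norm ?k)\<^sup>2)"
    using K_norm_test_vec_pos[OF v(2)] by simp
  then obtain N :: nat and c t h where
    less: "K_norm (?k - (\<Sum>i<N. K_scale (c i) (\<rho> (t i) (K_embed (h i))))) < sqrt ((K_norm ?k)\<^sup>2)"
    using minimal k unfolding minimal_dilation_def by blast
  define S where "S = (\<Sum>i<N. K_scale (c i) (\<rho> (t i) (K_embed (h i))))"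
  have S: "S \<in> K_space" "K_perp M S"
    using K_perp_rho_span[OF dilation] by (simp_all add: S_def)
  have "K_inner ?k S = 0"
  proof (rule K_inner_perp[OF _ _ S(2)])
    show "AE s in lborel. glue ?k s \<in> M"
      by (rule AE_I2) (simp add: glue_def test_vec_def closed_csubspace_add closed_csubspace_scaleR M v(1))
  qed (simp add: test_vec_def)
  \<comment> \<open>By Pythagoras, no element of the span is closer to \<open>?k\<close> than 0 is,
    against the chosen tolerance.\<close>
  then have "(K_norm ?k)\<^sup>2 \<le> (K_norm (?k - S))\<^sup>2"
    by (simp add: K_norm_diff[OF k S(1)])
  moreover have "0 \<le> K_norm (?k - S)"
    by (cases "?k - S") (auto intro!: add_nonneg_nonneg integral_nonneg_AE simp: set_lebesgue_integral_def)
  ultimately have "sqrt ((K_norm ?k)\<^sup>2) \<le> K_norm (?k - S)"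
    by (intro real_le_lsqrt) auto
  then show False
    using less by (simp add: S_def)
qed

end
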